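(* Let $N\ge 5$ be an odd integer, let $\epsilon>0$, and let $r_c=\sum_{n=1}^{N}(1/2)^n$. Then there exists $\delta>0$ such that for every $r\in(r_c,r_c+\delta)$ the co-moving system $$\epsilon\frac{dx_1}{dt}=w+x_1(x_1-1),\qquad \frac{dw}{dt}=-\sum_{n=1}^{N}x_1^n+r$$ has an asymptotically stable limit cycle $(x_1^*(t),w^*(t))$, and trajectories of the fast/slow system $$\epsilon\frac{dx_1}{dt}=x_2+\lambda+x_1(x_1-1),\qquad \frac{dx_2}{dt}=-\sum_{n=1}^{N}x_1^n,\qquad \frac{d\lambda}{dt}=r$$ follow the spiraling curves $(x_1,x_2,\lambda)=(x_1^*(t),\,w^*(t)-rt,\,rt)$, in the following sense: each such curve is a solution of the fast/slow system, and there is a neighborhood $U\subset\mathbb{R}^2$ of the closed orbit $\Gamma=\{(x_1^*(t),w^*(t)):t\in\mathbb{R}\}$ such that every solution $(x_1(t),x_2(t),\lambda(t))$ of the fast/slow system with $\lambda(t)=rt$ and $(x_1(0),x_2(0))\in U$ satisfies $\operatorname{dist}\big((x_1(t),x_2(t)+rt),\Gamma\big)\to 0$ as $t\to\infty$.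
   Context: The parameters $N$ and $\epsilon$ are fixed, and $\delta$ may depend on them. The co-moving system is obtained from the fast/slow system by the substitution $w=x_2+\lambda$, and the forcing is $\lambda(t)=rt$. A limit cycle is a nonconstant periodic solution whose orbit is an isolated closed orbit; it is asymptotically stable if its closed orbit $\Gamma$ is Lyapunov stable as an invariant set and attracts all trajectories starting in some neighborhood of $\Gamma$. *)

theory Defs
  imports "HOL-Analysis.Analysis"
begin

section \<open>Autonomous differential equations, closed orbits and limit cycles\<close>

text \<open>Derivatives are taken within \<open>J\<close>, so they are one-sided at endpoints belonging to \<open>J\<close>.\<close>

definition ode_solution ::
    "('a::real_normed_vector \<Rightarrow> 'a) \<Rightarrow> (real \<Rightarrow> 'a) \<Rightarrow> real set \<Rightarrow> bool" where
  "ode_solution f x J \<longleftrightarrow> (\<forall>t\<in>J. (x has_vector_derivative f (x t)) (at t within J))"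

definition nonconstant_periodic_solution ::
    "('a::real_normed_vector \<Rightarrow> 'a) \<Rightarrow> (real \<Rightarrow> 'a) \<Rightarrow> bool" where
  "nonconstant_periodic_solution f x \<longleftrightarrow>
     ode_solution f x UNIV \<and> (\<exists>T>0. \<forall>t. x (t + T) = x t) \<and> \<not> x constant_on UNIV"

definition closed_orbit :: "('a::real_normed_vector \<Rightarrow> 'a) \<Rightarrow> 'a set \<Rightarrow> bool" where
  "closed_orbit f \<Gamma> \<longleftrightarrow> (\<exists>x. nonconstant_periodic_solution f x \<and> \<Gamma> = range x)"

text \<open>Isolated: no other closed orbit passes through some neighborhood of \<open>range x\<close>.\<close>

definition limit_cycle :: "('a::real_normed_vector \<Rightarrow> 'a) \<Rightarrow> (real \<Rightarrow> 'a) \<Rightarrow> bool" where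
  "limit_cycle f x \<longleftrightarrow>
     nonconstant_periodic_solution f x \<and>
     (\<exists>U. open U \<and> range x \<subseteq> U \<and>
          (\<forall>\<Gamma>'. closed_orbit f \<Gamma>' \<and> \<Gamma>' \<inter> U \<noteq> {} \<longrightarrow> \<Gamma>' = range x))"

text \<open>Stability quantifies over solutions on all compact intervals \<open>[0, T]\<close>, so that it also
  constrains trajectories that are not known to exist for all forward times.\<close>

definition lyapunov_stable_set :: "('a::real_normed_vector \<Rightarrow> 'a) \<Rightarrow> 'a set \<Rightarrow> bool" where
  "lyapunov_stable_set f \<Gamma> \<longleftrightarrow>
     (\<forall>V. open V \<and> \<Gamma> \<subseteq> V \<longrightarrow>
        (\<exists>U. open U \<and> \<Gamma> \<subseteq> U \<and>
           (\<forall>x T. 0 \<le> T \<and> ode_solution f x {0..T} \<and> x 0 \<in> U \<longrightarrow> (\<forall>t\<in>{0..T}. x t \<in> V))))"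

text \<open>The existence clause says that trajectories starting in \<open>U\<close> do not blow up in finite
  time; without it, convergence would be required of the globally defined trajectories only.\<close>

definition attracting_set :: "('a::real_normed_vector \<Rightarrow> 'a) \<Rightarrow> 'a set \<Rightarrow> bool" where
  "attracting_set f \<Gamma> \<longleftrightarrow>
     (\<exists>U. open U \<and> \<Gamma> \<subseteq> U \<and>
        (\<forall>p\<in>U. \<exists>x. ode_solution f x {0..} \<and> x 0 = p) \<and>
        (\<forall>x. ode_solution f x {0..} \<and> x 0 \<in> U \<longrightarrow>
             ((\<lambda>t. infdist (x t) \<Gamma>) \<longlongrightarrow> 0) at_top))"

definition asymptotically_stable_limit_cycle ::
    "('a::real_normed_vector \<Rightarrow> 'a) \<Rightarrow> (real \<Rightarrow> 'a) \<Rightarrow> bool" where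
  "asymptotically_stable_limit_cycle f x \<longleftrightarrow>
     limit_cycle f x \<and> lyapunov_stable_set f (range x) \<and> attracting_set f (range x)"


section \<open>The fast/slow system and the co-moving system\<close>

text \<open>In both vector fields the factor \<open>\<epsilon>\<close> of the first derivative has been divided out.
  The co-moving variable is \<open>w = x2 + l\<close>, where \<open>l\<close> is the forcing \<open>\<lambda>\<close>.\<close>

definition fast_slow_field ::
    "nat \<Rightarrow> real \<Rightarrow> real \<Rightarrow> real \<times> real \<times> real \<Rightarrow> real \<times> real \<times> real" where
  "fast_slow_field N \<epsilon> r = (\<lambda>(x1, x2, l).
     ((x2 + l + x1 * (x1 - 1)) / \<epsilon>, - (\<Sum>n=1..N. x1 ^ n), r))"

definition comoving_field :: "nat \<Rightarrow> real \<Rightarrow> real \<Rightarrow> real \<times> real \<Rightarrow> real \<times> real" where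
  "comoving_field N \<epsilon> r = (\<lambda>(x1, w).
     ((w + x1 * (x1 - 1)) / \<epsilon>, - (\<Sum>n=1..N. x1 ^ n) + r))"

end

theory Submission
  imports Defs "HOL-Real_Asymp.Real_Asymp"
begin

text \<open>Let \<open>p\<close> be the sum of the powers, and let \<open>x\<close> be the root of \<open>p x = r\<close>; it lies slightly to the right of
\<open>1/2\<close> when \<open>r\<close> is slightly above \<open>r\<^sub>c = p (1/2)\<close>. The equilibrium \<open>(x, x * (1 - x))\<close> of the co-moving
system has a Jacobian of trace \<open>(2 * x - 1) / \<epsilon>\<close> and positive determinant, so that it loses its
stability through a Hopf bifurcation at \<open>r\<^sub>c\<close>. The bifurcation is supercritical because \<open>p\<close> is
strictly convex near \<open>1/2\<close>: the damping is an even function of the displacement, and it is the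
asymmetry of the restoring force that turns it into a net loss of energy at cubic order.

To make this quantitative put \<open>2 * x - 1 = \<kappa> * m\<^sup>2\<close> with \<open>\<kappa>\<^sup>2 = \<epsilon> * p' x\<close>, and magnify the
neighbourhood of the equilibrium by \<open>1 / m\<close>. Up to a constant change of time the system becomes
\<open>X' = Y + m * X\<^sup>2 + m\<^sup>2 * X\<close> and \<open>Y' = - X - m * b * X\<^sup>2 - m\<^sup>2 * h * X\<^sup>3 - \<dots>\<close>, a perturbed rotation
with \<open>b > 0\<close>. In polar coordinates the inverse radius \<open>1 / R\<close> changes, per unit of angle, by an
oscillating term of order \<open>m\<close> and further terms of order \<open>m\<^sup>2\<close>. An explicit near-identity change
of variable \<open>1 / R = z - O(m)\<close> removes the oscillating parts up to order \<open>m\<^sup>2\<close> and leaves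
\<open>dz/d\<theta> = m\<^sup>2 * (- z / 2 + b / (4 * z) + O(m))\<close>.

The bracket without \<open>O(m)\<close> is positive for small \<open>z\<close>, negative for large \<open>z\<close>, and strictly
decreasing on all of \<open>z > 0\<close>; this is what working with the inverse radius buys. The error term is
small together with its Lipschitz constant in \<open>z\<close>, so that for small \<open>m\<close> the exact equation keeps
these properties on a fixed interval \<open>{z1..z2}\<close> (lemmas \<open>F_expansion\<close> and \<open>small_admissible\<close>).

The rest is soft. A scalar equation, periodic in \<open>\<theta>\<close>, which points into the strip
\<open>z1 \<le> z \<le> z2\<close> and is uniformly dissipative has a contracting period map, hence exactly one periodic
solution in the strip, and all other solutions approach it exponentially. Turning the angle back into time
maps the solutions in the strip onto trajectories of the planar system. By uniqueness for
initial value problems they are the only trajectories that start in the corresponding annulus,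
so the periodic one is Lyapunov stable and attracting; and an attracting closed orbit is isolated,
since another closed orbit near it would have to converge to it
(locale \<open>rotating_strip\<close>, theorem \<open>asymptotically_stable_limit_cycle_exists\<close>). Finally the shear
\<open>w = x2 + r * t\<close> transfers everything to the fast/slow system.\<close>


section \<open>Initial value problems\<close>

lemma antiderivative_exists:
  fixes v :: "real \<Rightarrow> real"
  assumes "continuous_on UNIV v"
  obtains V where "V 0 = 0" "\<And>t. (V has_real_derivative v t) (at t)"
proof
  let ?V = "\<lambda>t::real. LBINT y=0..t. v y"
  show "?V 0 = 0" by (simp add: zero_ereal_def)
  fix t :: real
  have "continuous_on {-(\<bar>t\<bar>+1)..\<bar>t\<bar>+1} v"
    using assms continuous_on_subset by blast
  then have "(?V has_vector_derivative v t) (at t within {-(\<bar>t\<bar>+1)..\<bar>t\<bar>+1})"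
    using interval_integral_FTC2[of "-(\<bar>t\<bar>+1)" 0 "\<bar>t\<bar>+1" v t] by (simp add: zero_ereal_def)
  then show "(?V has_real_derivative v t) (at t)"
    by (subst (asm) at_within_interior)
       (auto simp: has_real_derivative_iff_has_vector_derivative interior_atLeastAtMost_real)
qed

text \<open>The exponential weight turns integration into a small operator: a large \<open>K\<close> makes the integral small
compared to the integrand, on the whole line at once.\<close>

lemma antiderivative_exp_bound:
  fixes V v :: "real \<Rightarrow> real"
  assumes V0: "V 0 = 0" and der: "\<And>t. (V has_real_derivative v t) (at t)"
    and bd: "\<And>t. \<bar>v t\<bar> \<le> B * exp (K * \<bar>t\<bar>)" and K: "K > 0"
  shows "\<bar>V t\<bar> \<le> B / K * exp (K * \<bar>t\<bar>)"
proof -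
  have B: "B \<ge> 0" using bd[of 0] by auto
  have fwd: "U t \<le> B / K * exp (K * t)"
    if U0: "U 0 = 0" and dU: "\<And>s. (U has_real_derivative u s) (at s)"
      and u: "\<And>s. u s \<le> B * exp (K * \<bar>s\<bar>)" and t: "t \<ge> 0" for U u t
  proof -
    have "B / K * exp (K * 0) - U 0 \<le> B / K * exp (K * t) - U t"
    proof (rule DERIV_nonneg_imp_nondecreasing[OF t])
      fix s assume s: "0 \<le> s" "s \<le> t"
      have "((\<lambda>s. B / K * exp (K * s) - U s) has_real_derivative B * exp (K * s) - u s) (at s)"
        using K by (auto intro!: derivative_eq_intros dU)
      moreover have "B * exp (K * s) - u s \<ge> 0" using u[of s] s by simp
      ultimately show "\<exists>y. ((\<lambda>s. B / K * exp (K * s) - U s) has_real_derivative y) (at s) \<and> 0 \<le> y"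
        by blast
    qed
    with U0 B K show ?thesis by (simp add: divide_simps)
  qed
  have der': "((\<lambda>s. V (- s)) has_real_derivative - v (- s)) (at s)" for s
    using DERIV_mirror[of V "v (- s)" s] der[of "- s"] by simp
  have v1: "v s \<le> B * exp (K * \<bar>s\<bar>)" and v2: "- v s \<le> B * exp (K * \<bar>s\<bar>)" for s
    using bd[of s] by linarith+
  show ?thesis
  proof (cases "t \<ge> 0")
    case True
    have "V t \<le> B / K * exp (K * t)"
      by (rule fwd[OF V0 der v1 True])
    moreover have "- V t \<le> B / K * exp (K * t)"
      by (rule fwd[of "\<lambda>s. - V s" "\<lambda>s. - v s"]) (use V0 True in \<open>auto intro!: DERIV_minus der v2\<close>)
    ultimately show ?thesis using True by auto
  next
    case False
    have v1': "v (- s) \<le> B * exp (K * \<bar>s\<bar>)" and v2': "- v (- s) \<le> B * exp (K * \<bar>s\<bar>)" for s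
      using v1[of "- s"] v2[of "- s"] by simp_all
    have "V (- (- t)) \<le> B / K * exp (K * (- t))"
      by (rule fwd[of "\<lambda>s. V (- s)" "\<lambda>s. - v (- s)"]) (use V0 False der' v2' in auto)
    moreover have "- V (- (- t)) \<le> B / K * exp (K * (- t))"
      by (rule fwd[of "\<lambda>s. - V (- s)" "\<lambda>s. v (- s)"])
         (use V0 False v1' DERIV_minus[OF der'] in auto)
    ultimately show ?thesis using False by auto
  qed
qed

text \<open>Picard's integral operator is contracting for the norm \<open>sup |exp (- K * |t|) * y t|\<close> as soon as
\<open>K > L\<close>, so that one application of Banach's theorem gives a solution on the whole line. The unknown
in the proof is the weighted difference \<open>exp (- K * |t|) * (y t - y0)\<close>, which is a bounded continuous function.\<close>

theorem scalar_ode_exists: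
  fixes f :: "real \<Rightarrow> real \<Rightarrow> real"
  assumes cont: "continuous_on UNIV (\<lambda>(t, y). f t y)"
    and bd: "\<And>t y. \<bar>f t y\<bar> \<le> M"
    and lip: "\<And>t y y'. \<bar>f t y - f t y'\<bar> \<le> L * \<bar>y - y'\<bar>"
  obtains y where "y t0 = y0" "\<And>t. (y has_real_derivative f t (y t)) (at t)"
proof -
  define K where "K = 2 * (\<bar>L\<bar> + 1)"
  have M: "M \<ge> 0" using bd[of 0 0] by linarith
  have K: "K > 0" "\<bar>L\<bar> / K \<le> 1/2" by (auto simp: K_def)
  define v where "v z s = f (t0 + s) (y0 + exp (K * \<bar>s\<bar>) * apply_bcontfun z s)" for z s
  have contv: "continuous_on UNIV (v z)" for z :: "real \<Rightarrow>\<^sub>C real"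
  proof -
    have "continuous_on UNIV ((\<lambda>(t, y). f t y) \<circ> (\<lambda>s. (t0 + s, y0 + exp (K * \<bar>s\<bar>) * apply_bcontfun z s)))"
      by (intro continuous_on_compose continuous_intros continuous_on_subset[OF cont]) auto
    then show ?thesis by (simp add: v_def[abs_def] o_def)
  qed
  have "\<exists>V. V 0 = 0 \<and> (\<forall>t. (V has_real_derivative v z t) (at t))" for z
    by (rule antiderivative_exists[OF contv[of z]]) blast
  then obtain V where V: "\<And>z. V z 0 = 0 \<and> (\<forall>t. (V z has_real_derivative v z t) (at t))"
    using choice[of "\<lambda>z V. V 0 = 0 \<and> (\<forall>t. (V has_real_derivative v z t) (at t))"] by blast
  define T where "T z = Bcontfun (\<lambda>t. exp (- K * \<bar>t\<bar>) * V z t)" for z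
  have Vb: "\<bar>V z t\<bar> \<le> M / K * exp (K * \<bar>t\<bar>)" for z t
  proof (rule antiderivative_exp_bound[of "V z" "v z" M K t])
    fix t
    have "M * 1 \<le> M * exp (K * \<bar>t\<bar>)"
      using K(1) M by (intro mult_left_mono) auto
    then show "\<bar>v z t\<bar> \<le> M * exp (K * \<bar>t\<bar>)"
      unfolding v_def using bd[of "t0 + t"] by (metis mult.right_neutral order_trans)
  qed (use V K(1) in auto)
  have app: "apply_bcontfun (T z) t = exp (- K * \<bar>t\<bar>) * V z t" for z t
  proof -
    have "continuous_on UNIV (V z)"
      using V DERIV_isCont continuous_at_imp_continuous_on by blast
    then have c: "continuous_on UNIV (\<lambda>t. exp (- K * \<bar>t\<bar>) * V z t)"
      by (intro continuous_intros)
    have "norm (exp (- K * \<bar>t\<bar>) * V z t) \<le> M / K" for t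
      using mult_left_mono[OF Vb[of z t], of "exp (- K * \<bar>t\<bar>)"]
      by (simp add: abs_mult exp_minus field_simps)
    then have "bounded (range (\<lambda>t. exp (- K * \<bar>t\<bar>) * V z t))"
      by (auto simp: bounded_iff)
    with c show ?thesis
      unfolding T_def by (subst Bcontfun_inverse) (auto simp: bcontfun_def)
  qed
  have contr: "dist (T z) (T z') \<le> 1/2 * dist z z'" for z z'
  proof (rule dist_bound)
    fix t
    have "\<bar>V z t - V z' t\<bar> \<le> (\<bar>L\<bar> * dist z z') / K * exp (K * \<bar>t\<bar>)"
    proof (rule antiderivative_exp_bound[of "\<lambda>t. V z t - V z' t" "\<lambda>t. v z t - v z' t" "\<bar>L\<bar> * dist z z'" K t])
      show "((\<lambda>t. V z t - V z' t) has_real_derivative v z t - v z' t) (at t)" for t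
        using V by (auto intro!: derivative_intros)
      fix t
      have "\<bar>v z t - v z' t\<bar> \<le> L * \<bar>exp (K * \<bar>t\<bar>) * (apply_bcontfun z t - apply_bcontfun z' t)\<bar>"
        unfolding v_def by (rule order_trans[OF lip]) (simp add: algebra_simps)
      also have "\<dots> \<le> \<bar>L\<bar> * (exp (K * \<bar>t\<bar>) * dist z z')"
        using dist_bounded[of z t z']
        by (intro mult_mono) (auto simp: abs_mult dist_real_def)
      finally show "\<bar>v z t - v z' t\<bar> \<le> \<bar>L\<bar> * dist z z' * exp (K * \<bar>t\<bar>)"
        by (simp add: mult_ac)
    qed (use V K(1) in auto)
    then have "exp (- K * \<bar>t\<bar>) * \<bar>V z t - V z' t\<bar> \<le> \<bar>L\<bar> / K * dist z z'"
      using mult_left_mono[of "\<bar>V z t - V z' t\<bar>" "(\<bar>L\<bar> * dist z z') / K * exp (K * \<bar>t\<bar>)" "exp (- K * \<bar>t\<bar>)"]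
      by (simp add: exp_minus field_simps)
    also have "\<dots> \<le> 1/2 * dist z z'"
      by (rule mult_right_mono) (rule K(2), simp)
    finally show "dist (apply_bcontfun (T z) t) (apply_bcontfun (T z') t) \<le> 1/2 * dist z z'"
      by (simp add: app dist_real_def abs_mult flip: right_diff_distrib)
  qed
  \<comment> \<open>The fixed point \<open>z\<close> is the weighted solution, which is \<open>V z\<close> before weighting.\<close>
  obtain z where z: "T z = z"
    using banach_fix_type[of "1/2" T] contr by auto
  have Vz: "V z s = exp (K * \<bar>s\<bar>) * apply_bcontfun z s" for s
    using app[of z s] z by (simp add: exp_minus)
  let ?y = "\<lambda>t. y0 + V z (t - t0)"
  show ?thesis
  proof (rule that[of ?y])
    show "?y t0 = y0" using V by simp
    fix t
    have "(?y has_real_derivative v z (t - t0)) (at t)"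
      using DERIV_shift[of "V z" "v z (t - t0)" t "- t0"] V
      by (auto intro!: derivative_eq_intros DERIV_chain2[where f = "V z"])
    then show "(?y has_real_derivative f t (?y t)) (at t)"
      by (simp add: v_def Vz)
  qed
qed

text \<open>Gronwall's inequality in the form used for uniqueness: \<open>exp (- 2 * L * s) * |u s|\<^sup>2\<close> cannot grow.\<close>

lemma vanish_if_derivative_bounded_by_norm:
  fixes u :: "real \<Rightarrow> 'a::real_inner"
  assumes u0: "u a = 0"
    and der: "\<And>t. t \<in> {a..b} \<Longrightarrow> (u has_vector_derivative u' t) (at t within {a..b})"
    and bd: "\<And>t. t \<in> {a..b} \<Longrightarrow> norm (u' t) \<le> L * norm (u t)"
    and t: "t \<in> {a..b}"
  shows "u t = 0"
proof -
  define e where "e s = exp (- 2 * L * s) * (u s \<bullet> u s)" for s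
  have "continuous_on {a..b} u"
    using der has_vector_derivative_continuous continuous_on_eq_continuous_within by blast
  then have cont: "continuous_on {a..t} e"
    unfolding e_def using t by (intro continuous_intros) (auto elim: continuous_on_subset)
  have "e t \<le> e a"
  proof (rule DERIV_nonpos_imp_decreasing_open[OF _ _ cont])
    show "a \<le> t" using t by simp
    fix s assume s: "a < s" "s < t"
    then have "(u has_vector_derivative u' s) (at s)"
      using der[of s] t at_within_Icc_at[of a s b] by auto
    then have "(u has_derivative (\<lambda>h. h *\<^sub>R u' s)) (at s)"
      by (simp add: has_vector_derivative_def)
    then have "((\<lambda>s. u s \<bullet> u s) has_derivative (\<lambda>h. h * (2 * (u s \<bullet> u' s)))) (at s)"
      by (auto intro!: derivative_eq_intros simp: inner_commute algebra_simps)
    then have "((\<lambda>s. u s \<bullet> u s) has_real_derivative 2 * (u s \<bullet> u' s)) (at s)"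
      unfolding has_field_derivative_def by (rule has_derivative_eq_rhs) (simp add: fun_eq_iff)
    then have 1: "(e has_real_derivative exp (- 2 * L * s) * (2 * (u s \<bullet> u' s) - 2 * L * (u s \<bullet> u s))) (at s)"
      unfolding e_def by (auto intro!: derivative_eq_intros simp: algebra_simps)
    have "u s \<bullet> u' s \<le> norm (u s) * norm (u' s)"
      by (rule norm_cauchy_schwarz)
    also have "\<dots> \<le> norm (u s) * (L * norm (u s))"
      using bd[of s] s t by (intro mult_left_mono) auto
    also have "\<dots> = L * (u s \<bullet> u s)"
      by (simp add: dot_square_norm power2_eq_square)
    finally have "exp (- 2 * L * s) * (2 * (u s \<bullet> u' s) - 2 * L * (u s \<bullet> u s)) \<le> 0"
      by (simp add: mult_le_0_iff)
    with 1 show "\<exists>y. (e has_real_derivative y) (at s) \<and> y \<le> 0" by blast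
  qed
  moreover have "e a = 0" using u0 by (simp add: e_def)
  ultimately have "u t \<bullet> u t \<le> 0"
    by (simp add: e_def mult_le_0_iff)
  then show ?thesis using inner_ge_zero[of "u t"] inner_eq_zero_iff[of "u t"] by linarith
qed

lemma ode_solution_unique:
  fixes g :: "'a::real_inner \<Rightarrow> 'a"
  assumes lip: "\<And>r. \<exists>L. \<forall>p\<in>cball 0 r. \<forall>q\<in>cball 0 r. dist (g p) (g q) \<le> L * dist p q"
    and x: "\<And>t. t \<in> {a..b} \<Longrightarrow> (x has_vector_derivative g (x t)) (at t within {a..b})"
    and y: "\<And>t. t \<in> {a..b} \<Longrightarrow> (y has_vector_derivative g (y t)) (at t within {a..b})"
    and init: "x a = y a" and t: "t \<in> {a..b}"
  shows "x t = y t"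
proof -
  have "continuous_on {a..b} x" "continuous_on {a..b} y"
    using x y has_vector_derivative_continuous continuous_on_eq_continuous_within by blast+
  then have "bounded (x ` {a..b} \<union> y ` {a..b})"
    by (simp add: compact_continuous_image compact_imp_bounded)
  then obtain r where "\<forall>p\<in>x ` {a..b} \<union> y ` {a..b}. norm p \<le> r"
    unfolding bounded_iff by blast
  then have r: "x s \<in> cball 0 r \<and> y s \<in> cball 0 r" if "s \<in> {a..b}" for s
    using that by auto
  obtain L where L: "\<And>p q. p \<in> cball 0 r \<Longrightarrow> q \<in> cball 0 r \<Longrightarrow> dist (g p) (g q) \<le> L * dist p q"
    using lip by blast
  have "x t - y t = 0"
  proof (rule vanish_if_derivative_bounded_by_norm[OF _ _ _ t])
    show "((\<lambda>s. x s - y s) has_vector_derivative g (x s) - g (y s)) (at s within {a..b})"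
      if "s \<in> {a..b}" for s
      using x y that by (intro derivative_intros)
    show "norm (g (x s) - g (y s)) \<le> L * norm (x s - y s)" if "s \<in> {a..b}" for s
      using L r that by (simp add: dist_norm)
  qed (simp add: init)
  then show ?thesis by simp
qed

text \<open>A positive speed \<open>h\<close> that is merely continuous still determines the motion: \<open>\<tau>\<close> is the time needed to
reach a position, and the motion \<open>\<theta>\<close> is its inverse.\<close>

lemma scalar_autonomous_flow:
  fixes h :: "real \<Rightarrow> real"
  assumes cont: "continuous_on UNIV h" and d: "0 < d" and lo: "\<And>s. d \<le> h s" and hi: "\<And>s. h s \<le> M"
  obtains \<tau> \<theta> where "\<tau> s0 = 0" "\<And>s. (\<tau> has_real_derivative 1 / h s) (at s)"
    "\<And>s. \<theta> (\<tau> s) = s" "\<And>t. \<tau> (\<theta> t) = t" 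
    "\<And>t. (\<theta> has_real_derivative h (\<theta> t)) (at t)"
proof -
  have pos: "0 < h s" for s using d lo[of s] by linarith
  then have M: "M > 0" using hi order_less_le_trans by blast
  have ne: "h s \<noteq> 0" for s using pos[of s] by simp
  have "continuous_on UNIV (\<lambda>s. 1 / h s)"
    using ne by (intro continuous_intros cont) auto
  then obtain V where V: "V 0 = 0" "\<And>t. (V has_real_derivative 1 / h t) (at t)"
    using antiderivative_exists by blast
  define \<tau> where "\<tau> s = V s - V s0" for s
  have der: "(\<tau> has_real_derivative 1 / h s) (at s)" for s
    unfolding \<tau>_def using DERIV_diff[OF V(2)[of s] DERIV_const[of "V s0"]] by simp
  \<comment> \<open>\<open>h \<le> M\<close> bounds the slope of \<open>\<tau>\<close> from below, which makes \<open>\<tau>\<close> onto and its inverse continuous.\<close>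
  have grow: "(s' - s) / M \<le> \<tau> s' - \<tau> s" if "s \<le> s'" for s s'
  proof -
    have "\<tau> s - s / M \<le> \<tau> s' - s' / M"
    proof (rule DERIV_nonneg_imp_nondecreasing[OF that])
      fix x
      have "((\<lambda>s. \<tau> s - s / M) has_real_derivative 1 / h x - 1 / M) (at x)"
        using M by (auto intro!: derivative_eq_intros der)
      moreover have "1 / h x - 1 / M \<ge> 0" using hi[of x] pos[of x] by (simp add: frac_le)
      ultimately show "\<exists>y. ((\<lambda>s. \<tau> s - s / M) has_real_derivative y) (at x) \<and> 0 \<le> y" by blast
    qed
    then show ?thesis by (simp add: diff_divide_distrib)
  qed
  have contt: "continuous_on A \<tau>" for A
    using der DERIV_isCont continuous_at_imp_continuous_on by blast
  have surj: "\<exists>s. \<tau> s = t" for t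
  proof -
    define a where "a = s0 - M * \<bar>t\<bar>" define b where "b = s0 + M * \<bar>t\<bar>"
    have ab: "a \<le> s0" "s0 \<le> b" using M by (auto simp: a_def b_def)
    have "\<tau> s0 = 0" by (simp add: \<tau>_def)
    then have "\<tau> a \<le> t" "t \<le> \<tau> b"
      using grow[OF ab(1)] grow[OF ab(2)] M by (auto simp: a_def b_def)
    then show ?thesis using IVT'[of \<tau> a t b] contt ab by auto
  qed
  \<comment> \<open>By \<open>surj\<close> and \<open>grow\<close> the value exists and is unique.\<close>
  define \<theta> where "\<theta> t = (SOME s. \<tau> s = t)" for t
  have inv1: "\<tau> (\<theta> t) = t" for t
    unfolding \<theta>_def by (rule someI_ex) (rule surj)
  have inj: "s = s'" if "\<tau> s = \<tau> s'" for s s'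
  proof (rule ccontr)
    assume "s \<noteq> s'"
    then have "0 < (s' - s) / M \<or> 0 < (s - s') / M"
      using M by (auto simp: zero_less_divide_iff)
    then show False
    proof
      assume "0 < (s' - s) / M"
      then show False using grow[of s s'] that M by (auto simp: zero_less_divide_iff divide_le_0_iff)
    next
      assume "0 < (s - s') / M"
      then show False using grow[of s' s] that M by (auto simp: zero_less_divide_iff divide_le_0_iff)
    qed
  qed
  have inv2: "\<theta> (\<tau> s) = s" for s by (rule inj) (rule inv1)
  have "dist (\<theta> t) (\<theta> t') \<le> M * dist t t'" for t t'
  proof -
    have "\<bar>\<theta> t - \<theta> t'\<bar> / M \<le> \<bar>t - t'\<bar>"
      using grow[of "\<theta> t" "\<theta> t'"] grow[of "\<theta> t'" "\<theta> t"] by (cases "\<theta> t \<le> \<theta> t'") (auto simp: inv1)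
    then show ?thesis using M by (simp add: dist_real_def pos_divide_le_eq mult.commute)
  qed
  then have "continuous_on UNIV \<theta>"
    using M by (intro lipschitz_on_continuous_on[of M]) (auto simp: lipschitz_on_def)
  then have ct: "isCont \<theta> t" for t by (simp add: continuous_on_eq_continuous_at)
  have derT: "(\<theta> has_real_derivative h (\<theta> t)) (at t)" for t
    using DERIV_inverse_function[where f = \<tau> and g = \<theta> and x = t and D = "1 / h (\<theta> t)" and a = "t - 1" and b = "t + 1"] der[of "\<theta> t"] inv1 ct ne[of "\<theta> t"]
    by (simp add: divide_inverse)
  show thesis
  proof (rule that)
    show "\<tau> s0 = 0" by (simp add: \<tau>_def)
  qed (fact der inv1 inv2 derT)+
qed


section \<open>Periodic orbits that attract\<close>

lemma periodic_iterate:
  fixes x :: "real \<Rightarrow> 'a"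
  assumes "\<And>t. x (t + T) = x t"
  shows "x (t + real n * T) = x t"
proof (induction n)
  case (Suc n)
  have "x (t + real (Suc n) * T) = x ((t + real n * T) + T)"
    by (simp add: algebra_simps)
  then show ?case using assms Suc by simp
qed simp

lemma range_periodic_eq_image:
  fixes x :: "real \<Rightarrow> 'a"
  assumes per: "\<And>t. x (t + T) = x t" and T: "T > 0"
  shows "range x = x ` {a..}"
proof -
  have "x s \<in> x ` {a..}" for s
  proof -
    obtain n where "a - s < real n * T"
      using ex_less_of_nat_mult[OF T, of "a - s"] by auto
    then have "s + real n * T \<in> {a..}" by simp
    then show ?thesis using periodic_iterate[of x T s n] per by (metis image_eqI)
  qed
  then show ?thesis by auto
qed

lemma compact_range_periodic:
  fixes x :: "real \<Rightarrow> 'a::metric_space"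
  assumes per: "\<And>t. x (t + T) = x t" and T: "T > 0" and cont: "continuous_on UNIV x"
  shows "compact (range x)"
proof -
  have "x s \<in> x ` {0..T}" for s
  proof -
    define n where "n = \<lfloor>s / T\<rfloor>"
    have 1: "of_int n * T \<le> s" "s \<le> (of_int n + 1) * T"
      using T floor_divide_lower[OF T, of s] floor_divide_upper[OF T, of s]
      by (auto simp: n_def less_imp_le)
    have "x (s - of_int n * T) = x s"
    proof (cases "n \<ge> 0")
      case True
      then show ?thesis
        using periodic_iterate[of x T "s - of_int n * T" "nat n"] per by simp
    next
      case False
      then show ?thesis using periodic_iterate[of x T s "nat (- n)"] per by simp
    qed
    moreover have "s - of_int n * T \<in> {0..T}" using 1 by (auto simp: algebra_simps)
    ultimately show ?thesis by (metis image_eqI)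
  qed
  then have "range x = x ` {0..T}" by auto
  moreover have "compact (x ` {0..T})"
    using cont continuous_on_subset by (intro compact_continuous_image) auto
  ultimately show ?thesis by simp
qed

lemma ode_solution_subset: "ode_solution g x S \<Longrightarrow> T \<subseteq> S \<Longrightarrow> ode_solution g x T"
  unfolding ode_solution_def using has_vector_derivative_within_subset by blast

lemma ode_solution_shift:
  assumes "ode_solution g x UNIV"
  shows "ode_solution g (\<lambda>t. x (t + s)) UNIV"
proof -
  have "((x \<circ> (\<lambda>t. t + s)) has_vector_derivative 1 *\<^sub>R g (x (t + s))) (at t)" for t
    using assms by (intro vector_diff_chain_at) (auto simp: ode_solution_def intro!: derivative_eq_intros)
  then show ?thesis by (simp add: ode_solution_def o_def)
qed

lemma ode_solution_unique_forward:
  fixes g :: "'a::real_inner \<Rightarrow> 'a"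
  assumes lip: "\<And>r. \<exists>L. \<forall>p\<in>cball 0 r. \<forall>q\<in>cball 0 r. dist (g p) (g q) \<le> L * dist p q"
    and "ode_solution g x {0..}" "ode_solution g y {0..}" "x 0 = y 0" "0 \<le> t"
  shows "x t = y t"
  by (rule ode_solution_unique[OF lip, of 0 t])
     (use assms(2-) ode_solution_subset[of g _ "{0..}" "{0..t}"] in \<open>auto simp: ode_solution_def\<close>)

text \<open>Attraction alone forces isolation. Along a second closed orbit the distance to the first
is periodic and tends to zero, hence vanishes; uniqueness of solutions then makes the two orbits equal.\<close>

lemma attracting_periodic_orbit_isolated:
  fixes g :: "'a::real_inner \<Rightarrow> 'a"
  assumes lip: "\<And>r. \<exists>L. \<forall>p\<in>cball 0 r. \<forall>q\<in>cball 0 r. dist (g p) (g q) \<le> L * dist p q"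
    and x: "nonconstant_periodic_solution g x" and attr: "attracting_set g (range x)"
  shows "limit_cycle g x"
proof -
  obtain T where T: "T > 0" "\<And>t. x (t + T) = x t" and sx: "ode_solution g x UNIV"
    using x by (auto simp: nonconstant_periodic_solution_def)
  have "continuous_on UNIV x"
    using sx has_vector_derivative_continuous continuous_at_imp_continuous_on
    unfolding ode_solution_def by blast
  then have closed: "closed (range x)"
    using compact_range_periodic[of x T] T compact_imp_closed by blast
  obtain U where U: "open U" "range x \<subseteq> U"
    and conv: "\<And>y. ode_solution g y {0..} \<Longrightarrow> y 0 \<in> U \<Longrightarrow> ((\<lambda>t. infdist (y t) (range x)) \<longlongrightarrow> 0) at_top"
    using attr unfolding attracting_set_def by blast
  have "\<Gamma>' = range x" if orb: "closed_orbit g \<Gamma>'" and meet: "\<Gamma>' \<inter> U \<noteq> {}" for \<Gamma>'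
  proof -
    obtain y S where y: "ode_solution g y UNIV" "\<Gamma>' = range y" "S > 0" "\<And>t. y (t + S) = y t"
      using orb by (auto simp: closed_orbit_def nonconstant_periodic_solution_def)
    obtain t0 where t0: "y t0 \<in> U" using meet y(2) by auto
    define v where "v t = y (t + t0)" for t
    have v: "ode_solution g v UNIV" "\<And>t. v (t + S) = v t"
      using ode_solution_shift[OF y(1), of t0] y(4)[of "t + t0" for t]
      by (auto simp: v_def[abs_def] add_ac)
    have "((\<lambda>t. infdist (v t) (range x)) \<longlongrightarrow> 0) at_top"
      using conv[of v] ode_solution_subset[OF v(1)] t0 by (simp add: v_def)
    \<comment> \<open>Along a periodic solution the distance to \<open>range x\<close> is periodic; tending to \<open>0\<close>, it vanishes.\<close>
    have in_orbit: "v t \<in> range x" for t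
    proof -
      have "filterlim (\<lambda>n::nat. t + real n * S) at_top sequentially"
        using y(3) by (intro filterlim_tendsto_add_at_top[OF tendsto_const]
          filterlim_at_top_mult_tendsto_pos[OF tendsto_const] filterlim_real_sequentially)
      then have "(\<lambda>n::nat. infdist (v (t + real n * S)) (range x)) \<longlonglongrightarrow> 0"
        using \<open>((\<lambda>t. infdist (v t) (range x)) \<longlongrightarrow> 0) at_top\<close>
        by (rule filterlim_compose[rotated])
      then have "infdist (v t) (range x) = 0"
        by (simp add: periodic_iterate[of v S] v(2) LIMSEQ_const_iff)
      then show ?thesis
        using in_closed_iff_infdist_zero[OF closed] by blast
    qed
    have "\<Gamma>' \<subseteq> range x"
      using in_orbit[of "t - t0" for t] y(2) by (auto simp: v_def)
    moreover have "range x \<subseteq> \<Gamma>'"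
    proof -
      obtain s where s: "v 0 = x s" using in_orbit[of 0] by auto
      have eq: "v t = x (t + s)" if "t \<ge> 0" for t
        using ode_solution_unique_forward[OF lip, of v "\<lambda>t. x (t + s)" t] s that
          ode_solution_subset[OF v(1), of "{0..}"]
          ode_solution_subset[OF ode_solution_shift[OF sx, of s], of "{0..}"] by auto
      have "x r \<in> \<Gamma>'" if "r \<ge> s" for r
        using eq[of "r - s"] that y(2) by (metis add.commute diff_add_cancel diff_ge_0_iff_ge rangeI v_def)
      then show ?thesis using range_periodic_eq_image[of x T s] T by auto
    qed
    ultimately show ?thesis by blast
  qed
  then show ?thesis using x U unfolding limit_cycle_def by blast
qed


section \<open>Limit cycles from a dissipative equation in a strip\<close>

text \<open>For use at the edges of a strip: a function that cannot increase while it is above \<open>c\<close> never gets above \<open>c\<close>.\<close>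

lemma stays_below_barrier:
  fixes \<zeta> :: "real \<Rightarrow> real"
  assumes cont: "continuous_on {a..b} \<zeta>" and init: "\<zeta> a \<le> c" and le: "a \<le> b"
    and slope: "\<And>t. a < t \<Longrightarrow> t < b \<Longrightarrow> c \<le> \<zeta> t \<Longrightarrow> \<exists>y. (\<zeta> has_real_derivative y) (at t) \<and> y \<le> 0"
  shows "\<zeta> b \<le> c"
proof -
  define S where "S = {a..b} \<inter> \<zeta> -` {..c}"
  have "closed S"
    unfolding S_def by (rule continuous_closed_preimage[OF cont]) auto
  moreover have "bounded S"
    by (rule bounded_subset[of "{a..b}"]) (auto simp: S_def)
  ultimately have "compact S" by (simp add: compact_eq_bounded_closed)
  moreover have "a \<in> S" using init le by (simp add: S_def)
  \<comment> \<open>After the last time \<open>s\<close> in \<open>S\<close> the function would be above \<open>c\<close>, hence nonincreasing.\<close>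
  ultimately obtain s where s: "s \<in> S" "\<And>t. t \<in> S \<Longrightarrow> t \<le> s"
    using compact_attains_sup[of S] by blast
  have s': "a \<le> s" "s \<le> b" "\<zeta> s \<le> c" using s(1) by (auto simp: S_def)
  have "\<zeta> b \<le> \<zeta> s"
  proof (rule DERIV_nonpos_imp_decreasing_open[OF s'(2)])
    show "continuous_on {s..b} \<zeta>" using cont s' continuous_on_subset by fastforce
    fix t assume t: "s < t" "t < b"
    then have "t \<notin> S" using s(2)[of t] by auto
    then have "c \<le> \<zeta> t" using t s' by (simp add: S_def)
    then show "\<exists>y. (\<zeta> has_real_derivative y) (at t) \<and> y \<le> 0" using slope[of t] t s' by simp
  qed
  then show ?thesis using s'(3) by linarith
qed

text \<open>The strip of angles \<open>\<theta>\<close> and heights \<open>z \<in> {z1..z2}\<close> is the universal cover of an annulus in the plane, and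
\<open>\<Psi>\<close> is the covering map. The trajectories of the planar field \<open>g\<close> in the annulus are the images of
the solutions of \<open>dz/d\<theta> = F \<theta> z\<close>, traversed with angular velocity \<open>D\<close>; this is what \<open>\<Psi>_curve\<close> says.
The scalar equation points inwards at both edges and is dissipative with rate \<open>\<kappa>\<close>. The
single constant \<open>L\<close> serves as a bound wherever only finiteness matters.\<close>

locale rotating_strip =
  fixes F D :: "real \<Rightarrow> real \<Rightarrow> real" and \<Psi> :: "real \<Rightarrow> real \<Rightarrow> real \<times> real"
    and g :: "real \<times> real \<Rightarrow> real \<times> real" and z1 z2 \<kappa> L d :: real
  assumes z12: "z1 < z2" and \<kappa>_pos: "0 < \<kappa>" and d_pos: "0 < d" and L_nonneg: "0 \<le> L"
    and F_cont: "continuous_on (UNIV \<times> {z1..z2}) (\<lambda>(\<theta>, z). F \<theta> z)"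
    and D_cont: "continuous_on (UNIV \<times> {z1..z2}) (\<lambda>(\<theta>, z). D \<theta> z)"
    and \<Psi>_cont: "continuous_on (UNIV \<times> {z1..z2}) (\<lambda>(\<theta>, z). \<Psi> \<theta> z)"
    and F_periodic: "F (\<theta> + 2 * pi) z = F \<theta> z"
    and D_periodic: "D (\<theta> + 2 * pi) z = D \<theta> z"
    and \<Psi>_periodic: "\<Psi> (\<theta> + 2 * pi) z = \<Psi> \<theta> z"
    and F_bound: "z \<in> {z1..z2} \<Longrightarrow> \<bar>F \<theta> z\<bar> \<le> L"
    and F_lip: "z \<in> {z1..z2} \<Longrightarrow> z' \<in> {z1..z2} \<Longrightarrow> \<bar>F \<theta> z - F \<theta> z'\<bar> \<le> L * \<bar>z - z'\<bar>"
    and F_inward: "0 < F \<theta> z1" "F \<theta> z2 < 0"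
    and F_diss: "z \<in> {z1..z2} \<Longrightarrow> z' \<in> {z1..z2} \<Longrightarrow>
      (F \<theta> z - F \<theta> z') * (z - z') \<le> - \<kappa> * (z - z')\<^sup>2"
    and D_bounds: "z \<in> {z1..z2} \<Longrightarrow> d \<le> D \<theta> z" "z \<in> {z1..z2} \<Longrightarrow> D \<theta> z \<le> L"
    and \<Psi>_lip: "z \<in> {z1..z2} \<Longrightarrow> z' \<in> {z1..z2} \<Longrightarrow> dist (\<Psi> \<theta> z) (\<Psi> \<theta> z') \<le> L * \<bar>z - z'\<bar>"
    and \<Psi>_inj: "z \<in> {z1..z2} \<Longrightarrow> z' \<in> {z1..z2} \<Longrightarrow> \<Psi> \<theta> z = \<Psi> \<theta>' z' \<Longrightarrow>
      z = z' \<and> (\<exists>n::int. \<theta>' = \<theta> + 2 * pi * n)"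
    and \<Psi>_curve: "\<zeta> \<theta> \<in> {z1..z2} \<Longrightarrow> (\<zeta> has_real_derivative F \<theta> (\<zeta> \<theta>)) (at \<theta>) \<Longrightarrow>
      ((\<lambda>s. \<Psi> s (\<zeta> s)) has_vector_derivative (1 / D \<theta> (\<zeta> \<theta>)) *\<^sub>R g (\<Psi> \<theta> (\<zeta> \<theta>))) (at \<theta>)"
    and g_lip: "\<exists>K. \<forall>p\<in>cball 0 r. \<forall>q\<in>cball 0 r. dist (g p) (g q) \<le> K * dist p q"
begin

text \<open>Evaluating \<open>F\<close> at \<open>retract z\<close> extends the equation boundedly and globally Lipschitz to all real \<open>z\<close>
without changing it in the strip.\<close>

definition retract :: "real \<Rightarrow> real" where
  "retract z = max z1 (min z2 z)"

lemma retract_in: "retract z \<in> {z1..z2}"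
  and retract_id: "z \<in> {z1..z2} \<Longrightarrow> retract z = z"
  and retract_lip: "\<bar>retract z - retract z'\<bar> \<le> \<bar>z - z'\<bar>"
  using z12 by (auto simp: retract_def max_def min_def)

lemma retract_cont: "continuous_on A retract"
  unfolding retract_def[abs_def] by (intro continuous_intros)

definition strip_solution :: "(real \<Rightarrow> real) \<Rightarrow> bool" where
  "strip_solution \<zeta> \<longleftrightarrow> (\<forall>\<theta>. (\<zeta> has_real_derivative F \<theta> (retract (\<zeta> \<theta>))) (at \<theta>))"

lemma strip_solution_cont: "strip_solution \<zeta> \<Longrightarrow> continuous_on A \<zeta>"
  unfolding strip_solution_def using DERIV_isCont continuous_at_imp_continuous_on by blast

lemma F_retract_lip: "\<bar>F \<theta> (retract z) - F \<theta> (retract z')\<bar> \<le> L * \<bar>z - z'\<bar>"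
  by (rule order_trans[OF F_lip[OF retract_in retract_in]])
     (intro mult_left_mono retract_lip L_nonneg)

lemma strip_solution_exists:
  obtains \<zeta> where "\<zeta> \<theta>\<^sub>0 = z\<^sub>0" "strip_solution \<zeta>"
proof -
  have "continuous_on UNIV (\<lambda>p::real \<times> real. (fst p, retract (snd p)))"
    by (intro continuous_on_Pair continuous_on_fst continuous_on_id
        continuous_on_compose2[OF retract_cont] continuous_on_snd) auto
  then have "continuous_on UNIV (\<lambda>p::real \<times> real. (\<lambda>(\<theta>, z). F \<theta> z) (fst p, retract (snd p)))"
    by (rule continuous_on_compose2[OF F_cont]) (use retract_in in auto)
  then have "continuous_on UNIV (\<lambda>(\<theta>, z). F \<theta> (retract z))"
    by (simp add: case_prod_beta)
  from scalar_ode_exists[OF this, of L L \<theta>\<^sub>0 z\<^sub>0] show thesis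
    using F_bound[OF retract_in] F_retract_lip that unfolding strip_solution_def by blast
qed

lemma strip_solution_unique:
  assumes "strip_solution \<zeta>" "strip_solution \<xi>" "\<zeta> \<theta>\<^sub>0 = \<xi> \<theta>\<^sub>0"
  shows "\<zeta> \<theta> = \<xi> \<theta>"
proof -
  define w where "w s = F s (retract (\<zeta> s)) - F s (retract (\<xi> s))" for s
  have der: "((\<lambda>s. \<zeta> s - \<xi> s) has_real_derivative w s) (at s)" for s
    unfolding w_def using assms by (intro DERIV_diff) (auto simp: strip_solution_def)
  have bd: "\<bar>w s\<bar> \<le> L * \<bar>\<zeta> s - \<xi> s\<bar>" for s
    unfolding w_def by (rule F_retract_lip)
  have "\<zeta> \<theta> - \<xi> \<theta> = 0"
  proof (cases "\<theta>\<^sub>0 \<le> \<theta>")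
    case True
    show ?thesis
    proof (rule vanish_if_derivative_bounded_by_norm[where u = "\<lambda>s. \<zeta> s - \<xi> s" and t = \<theta> and u' = w and a = \<theta>\<^sub>0 and b = \<theta> and L = L])
      show "((\<lambda>s. \<zeta> s - \<xi> s) has_vector_derivative w s) (at s within {\<theta>\<^sub>0..\<theta>})" for s
        using der[of s] has_vector_derivative_at_within
        by (simp add: has_real_derivative_iff_has_vector_derivative)
    qed (use assms True bd in auto)
  next
    case False
    have "\<zeta> (- (- \<theta>)) - \<xi> (- (- \<theta>)) = 0"
    proof (rule vanish_if_derivative_bounded_by_norm[where u = "\<lambda>s. \<zeta> (- s) - \<xi> (- s)" and t = "- \<theta>" and u' = "\<lambda>s. - w (- s)" and a = "- \<theta>\<^sub>0" and b = "- \<theta>" and L = L])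
      have "((\<lambda>s. \<zeta> (- s) - \<xi> (- s)) has_real_derivative - w (- s)) (at s)" for s
        using DERIV_mirror[of "\<lambda>s. \<zeta> s - \<xi> s" "w (- s)" s] der[of "- s"] by simp
      then show "((\<lambda>s. \<zeta> (- s) - \<xi> (- s)) has_vector_derivative - w (- s)) (at s within {- \<theta>\<^sub>0..- \<theta>})" for s
        using has_vector_derivative_at_within
        unfolding has_real_derivative_iff_has_vector_derivative by blast
      show "norm (- w (- s)) \<le> L * norm (\<zeta> (- s) - \<xi> (- s))" for s
        using bd[of "- s"] by simp
    qed (use assms False in auto)
    then show ?thesis by simp
  qed
  then show ?thesis by simp
qed

lemma strip_solution_stays:
  assumes sol: "strip_solution \<zeta>" and init: "\<zeta> \<theta>\<^sub>0 \<in> {z1..z2}" and le: "\<theta>\<^sub>0 \<le> \<theta>"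
  shows "\<zeta> \<theta> \<in> {z1..z2}"
proof -
  have cont: "continuous_on {\<theta>\<^sub>0..\<theta>} \<zeta>" by (rule strip_solution_cont[OF sol])
  have "\<zeta> \<theta> \<le> z2"
  proof (rule stays_below_barrier[OF cont _ le])
    fix t assume "z2 \<le> \<zeta> t"
    then have "retract (\<zeta> t) = z2" using z12 by (simp add: retract_def)
    then show "\<exists>y. (\<zeta> has_real_derivative y) (at t) \<and> y \<le> 0"
      using sol F_inward(2)[of t] unfolding strip_solution_def by (metis less_imp_le)
  qed (use init in simp)
  moreover have "- \<zeta> \<theta> \<le> - z1"
  proof (rule stays_below_barrier[OF continuous_on_minus[OF cont] _ le])
    fix t assume "- z1 \<le> - \<zeta> t"
    then have "retract (\<zeta> t) = z1" using z12 by (simp add: retract_def)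
    then have "((\<lambda>s. - \<zeta> s) has_real_derivative - F t z1) (at t)"
      using sol DERIV_minus unfolding strip_solution_def by metis
    then show "\<exists>y. ((\<lambda>s. - \<zeta> s) has_real_derivative y) (at t) \<and> y \<le> 0"
      using F_inward(1)[of t] by (metis less_imp_le neg_le_0_iff_le)
  qed (use init in simp)
  ultimately show ?thesis by simp
qed

text \<open>Dissipativity controls the derivative of the squared difference of two solutions.\<close>

lemma strip_solutions_contract:
  assumes sol: "strip_solution \<zeta>" "strip_solution \<xi>"
    and init: "\<zeta> \<theta>\<^sub>0 \<in> {z1..z2}" "\<xi> \<theta>\<^sub>0 \<in> {z1..z2}" and le: "\<theta>\<^sub>0 \<le> \<theta>"
  shows "\<bar>\<zeta> \<theta> - \<xi> \<theta>\<bar> \<le> exp (- \<kappa> * (\<theta> - \<theta>\<^sub>0)) * \<bar>\<zeta> \<theta>\<^sub>0 - \<xi> \<theta>\<^sub>0\<bar>"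
proof -
  define e where "e s = exp (2 * \<kappa> * (s - \<theta>\<^sub>0)) * (\<zeta> s - \<xi> s)\<^sup>2" for s
  have "e \<theta> \<le> e \<theta>\<^sub>0"
  proof (rule DERIV_nonpos_imp_nonincreasing[OF le])
    fix s assume s: "\<theta>\<^sub>0 \<le> s" "s \<le> \<theta>"
    have in_strip: "\<zeta> s \<in> {z1..z2}" "\<xi> s \<in> {z1..z2}"
      using strip_solution_stays sol init s(1) by blast+
    then have "(\<zeta> has_real_derivative F s (\<zeta> s)) (at s)" "(\<xi> has_real_derivative F s (\<xi> s)) (at s)"
      using sol retract_id unfolding strip_solution_def by metis+
    then have "(e has_real_derivative 2 * exp (2 * \<kappa> * (s - \<theta>\<^sub>0)) *
        ((F s (\<zeta> s) - F s (\<xi> s)) * (\<zeta> s - \<xi> s) + \<kappa> * (\<zeta> s - \<xi> s)\<^sup>2)) (at s)"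
      unfolding e_def by (auto intro!: derivative_eq_intros simp: algebra_simps power2_eq_square)
    moreover have "(F s (\<zeta> s) - F s (\<xi> s)) * (\<zeta> s - \<xi> s) + \<kappa> * (\<zeta> s - \<xi> s)\<^sup>2 \<le> 0"
      using F_diss[OF in_strip, of s] by simp
    ultimately show "\<exists>y. (e has_real_derivative y) (at s) \<and> y \<le> 0"
      by (metis exp_ge_zero mult_nonneg_nonpos mult_nonneg_nonneg zero_le_numeral)
  qed
  then have "exp (2 * \<kappa> * (\<theta> - \<theta>\<^sub>0)) * (\<zeta> \<theta> - \<xi> \<theta>)\<^sup>2 \<le> (\<zeta> \<theta>\<^sub>0 - \<xi> \<theta>\<^sub>0)\<^sup>2"
    by (simp add: e_def)
  moreover have "exp (2 * \<kappa> * (\<theta> - \<theta>\<^sub>0)) = (exp (\<kappa> * (\<theta> - \<theta>\<^sub>0)))\<^sup>2"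
    by (simp add: exp_double[symmetric] mult.assoc)
  ultimately have "(exp (\<kappa> * (\<theta> - \<theta>\<^sub>0)) * (\<zeta> \<theta> - \<xi> \<theta>))\<^sup>2 \<le> (\<zeta> \<theta>\<^sub>0 - \<xi> \<theta>\<^sub>0)\<^sup>2"
    by (simp add: power_mult_distrib)
  then have "exp (\<kappa> * (\<theta> - \<theta>\<^sub>0)) * \<bar>\<zeta> \<theta> - \<xi> \<theta>\<bar> \<le> \<bar>\<zeta> \<theta>\<^sub>0 - \<xi> \<theta>\<^sub>0\<bar>"
    by (simp add: abs_le_square_iff[symmetric] abs_mult)
  then show ?thesis
    by (simp add: exp_minus divide_simps mult.commute)
qed

text \<open>The fixed point of the period map, found by Banach's theorem from the contraction over one turn.\<close>

lemma periodic_strip_solution: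
  obtains \<zeta> where "strip_solution \<zeta>" "\<And>\<theta>. \<zeta> (\<theta> + 2 * pi) = \<zeta> \<theta>" "\<And>\<theta>. \<zeta> \<theta> \<in> {z1<..<z2}"
proof -
  have "\<exists>\<zeta>. \<zeta> 0 = z \<and> strip_solution \<zeta>" for z
    using strip_solution_exists[of 0 z] by blast
  then obtain \<phi> where \<phi>: "\<And>z. \<phi> z 0 = z \<and> strip_solution (\<phi> z)"
    by metis
  have "\<exists>!z. z \<in> {z1..z2} \<and> \<phi> z (2 * pi) = z"
  proof (rule Banach_fix[where c = "exp (- \<kappa> * (2 * pi))"])
    show "(\<lambda>z. \<phi> z (2 * pi)) ` {z1..z2} \<subseteq> {z1..z2}"
      using strip_solution_stays[of "\<phi> z" 0 "2 * pi" for z] \<phi> by fastforce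
    show "dist (\<phi> z (2 * pi)) (\<phi> z' (2 * pi)) \<le> exp (- \<kappa> * (2 * pi)) * dist z z'"
      if "z \<in> {z1..z2}" "z' \<in> {z1..z2}" for z z'
      using strip_solutions_contract[of "\<phi> z" "\<phi> z'" 0 "2 * pi"] \<phi> that by (simp add: dist_real_def)
  qed (use z12 \<kappa>_pos in \<open>auto simp: complete_eq_closed\<close>)
  then obtain z where z: "z \<in> {z1..z2}" "\<phi> z (2 * pi) = z" by blast
  define \<zeta> where "\<zeta> = \<phi> z"
  have sol: "strip_solution \<zeta>" and z0: "\<zeta> 0 = z" using \<phi> by (auto simp: \<zeta>_def)
  have "strip_solution (\<lambda>\<theta>. \<zeta> (\<theta> + 2 * pi))"
    unfolding strip_solution_def
  proof
    fix \<theta>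
    show "((\<lambda>\<theta>. \<zeta> (\<theta> + 2 * pi)) has_real_derivative F \<theta> (retract (\<zeta> (\<theta> + 2 * pi)))) (at \<theta>)"
      using sol[unfolded strip_solution_def, rule_format, of "\<theta> + 2 * pi"]
      by (simp add: DERIV_shift F_periodic)
  qed
  then have per: "\<zeta> (\<theta> + 2 * pi) = \<zeta> \<theta>" for \<theta>
    using strip_solution_unique[of "\<lambda>\<theta>. \<zeta> (\<theta> + 2 * pi)" \<zeta> 0 \<theta>] sol z z0 by (simp add: \<zeta>_def)
  have closed_strip: "\<zeta> \<theta> \<in> {z1..z2}" for \<theta>
  proof -
    have "\<zeta> \<theta> \<in> \<zeta> ` {0..}"
      using range_periodic_eq_image[of \<zeta> "2 * pi" 0] per by auto
    then show ?thesis using strip_solution_stays[OF sol, of 0] z z0 by auto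
  qed
  \<comment> \<open>At a contact with an edge the slope of \<open>\<zeta>\<close> would point strictly inwards, so that \<open>\<zeta>\<close> would
    have been outside of the strip just before.\<close>
  have open_strip: "\<zeta> \<theta> \<in> {z1<..<z2}" for \<theta>
  proof -
    have der: "(\<zeta> has_real_derivative F \<theta> (\<zeta> \<theta>)) (at \<theta>)"
      using sol retract_id[OF closed_strip] unfolding strip_solution_def by metis
    have "\<zeta> \<theta> \<noteq> z2"
    proof
      assume eq: "\<zeta> \<theta> = z2"
      obtain \<delta> where "\<delta> > 0" "\<And>h. 0 < h \<Longrightarrow> h < \<delta> \<Longrightarrow> \<zeta> \<theta> < \<zeta> (\<theta> - h)"
        using DERIV_neg_dec_left[OF der] F_inward(2)[of \<theta>] eq by auto
      from this(2)[of "\<delta> / 2"] this(1) show False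
        using closed_strip[of "\<theta> - \<delta> / 2"] eq by auto
    qed
    moreover have "\<zeta> \<theta> \<noteq> z1"
    proof
      assume eq: "\<zeta> \<theta> = z1"
      obtain \<delta> where "\<delta> > 0" "\<And>h. 0 < h \<Longrightarrow> h < \<delta> \<Longrightarrow> \<zeta> (\<theta> - h) < \<zeta> \<theta>"
        using DERIV_pos_inc_left[OF der] F_inward(1)[of \<theta>] eq by auto
      from this(2)[of "\<delta> / 2"] this(1) show False
        using closed_strip[of "\<theta> - \<delta> / 2"] eq by auto
    qed
    ultimately show ?thesis using closed_strip[of \<theta>] by auto
  qed
  show thesis by (rule that[OF sol per open_strip])
qed

lemma strip_solution_clock:
  assumes sol: "strip_solution \<zeta>"
  obtains \<tau> \<theta> where "\<tau> \<theta>\<^sub>0 = 0" "\<And>s. (\<tau> has_real_derivative 1 / D s (retract (\<zeta> s))) (at s)"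
    "\<And>s. \<theta> (\<tau> s) = s" "\<And>t. \<tau> (\<theta> t) = t"
    "\<And>t. (\<theta> has_real_derivative D (\<theta> t) (retract (\<zeta> (\<theta> t)))) (at t)"
proof -
  have "continuous_on UNIV (\<lambda>s. (s, retract (\<zeta> s)))"
    by (intro continuous_on_Pair continuous_on_id continuous_on_compose2[OF retract_cont]
        strip_solution_cont[OF sol]) auto
  then have "continuous_on UNIV (\<lambda>s. (\<lambda>(\<theta>, z). D \<theta> z) (s, retract (\<zeta> s)))"
    by (rule continuous_on_compose2[OF D_cont]) (use retract_in in auto)
  then have "continuous_on UNIV (\<lambda>s. D s (retract (\<zeta> s)))" by simp
  from scalar_autonomous_flow[OF this d_pos D_bounds(1)[OF retract_in] D_bounds(2)[OF retract_in], of \<theta>\<^sub>0]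
  show thesis using that by blast
qed

lemma strip_solution_lifts:
  assumes sol: "strip_solution \<zeta>" and mem: "\<zeta> (\<theta> t) \<in> {z1..z2}"
    and \<theta>: "(\<theta> has_real_derivative D (\<theta> t) (retract (\<zeta> (\<theta> t)))) (at t)"
  shows "((\<lambda>t. \<Psi> (\<theta> t) (\<zeta> (\<theta> t))) has_vector_derivative g (\<Psi> (\<theta> t) (\<zeta> (\<theta> t)))) (at t)"
proof -
  let ?s = "\<theta> t"
  have "(\<zeta> has_real_derivative F ?s (\<zeta> ?s)) (at ?s)"
    using sol retract_id[OF mem] unfolding strip_solution_def by metis
  note lifted = \<Psi>_curve[OF mem this]
  have "(\<theta> has_vector_derivative D ?s (\<zeta> ?s)) (at t)"
    using \<theta> retract_id[OF mem] by (simp add: has_real_derivative_iff_has_vector_derivative)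
  from vector_diff_chain_at[OF this lifted] show ?thesis
    using D_bounds(1)[OF mem, of ?s] d_pos by (simp add: o_def)
qed

text \<open>The covering map is continuous and injective over any open interval of angles of length \<open>2 * pi\<close>, so that invariance of
domain makes the image of an open set of the strip open.\<close>

lemma tube_open:
  assumes cont: "continuous_on UNIV \<zeta>"
  shows "open {\<Psi> \<theta> z |\<theta> z. z \<in> {z1<..<z2} \<and> \<bar>z - \<zeta> \<theta>\<bar> < \<eta>}"
proof -
  define S where "S \<alpha> = {p. \<alpha> < fst p \<and> fst p < \<alpha> + 2 * pi \<and> z1 < snd p \<and> snd p < z2 \<and>
    \<bar>snd p - \<zeta> (fst p)\<bar> < \<eta>}" for \<alpha>
  let ?f = "\<lambda>(\<theta>, z). \<Psi> \<theta> z"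
  have "open (?f ` S \<alpha>)" for \<alpha>
  proof (rule invariance_of_domain)
    show "continuous_on (S \<alpha>) ?f"
      by (rule continuous_on_subset[OF \<Psi>_cont]) (auto simp: S_def)
    have "continuous_on UNIV (\<lambda>p::real \<times> real. \<zeta> (fst p))"
      by (rule continuous_on_compose2[OF cont]) (auto intro!: continuous_intros)
    then show "open (S \<alpha>)"
      unfolding S_def by (intro open_Collect_conj open_Collect_less continuous_intros)
    show "inj_on ?f (S \<alpha>)"
    proof (rule inj_onI)
      fix p q assume p: "p \<in> S \<alpha>" and q: "q \<in> S \<alpha>" and eq: "?f p = ?f q"
      from p q have mem: "snd p \<in> {z1..z2}" "snd q \<in> {z1..z2}" by (auto simp: S_def)
      obtain n :: int where n: "fst q = fst p + 2 * pi * n" and z: "snd p = snd q"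
        using \<Psi>_inj[OF mem, of "fst p" "fst q"] eq by (auto simp: case_prod_beta)
      have "\<bar>fst q - fst p\<bar> < 2 * pi" using p q by (auto simp: S_def)
      then have "\<bar>2 * pi * n\<bar> < 2 * pi * 1" using n by simp
      then have "\<bar>real_of_int n\<bar> < 1" by (simp add: abs_mult)
      then have "n = 0" by linarith
      then show "p = q" using n z by (simp add: prod_eq_iff)
    qed
  qed
  then have "open (\<Union>\<alpha>. ?f ` S \<alpha>)" by blast
  also have "(\<Union>\<alpha>. ?f ` S \<alpha>) = {\<Psi> \<theta> z |\<theta> z. z \<in> {z1<..<z2} \<and> \<bar>z - \<zeta> \<theta>\<bar> < \<eta>}"
  proof (intro equalityI subsetI)
    fix x assume "x \<in> {\<Psi> \<theta> z |\<theta> z. z \<in> {z1<..<z2} \<and> \<bar>z - \<zeta> \<theta>\<bar> < \<eta>}"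
    then obtain \<theta> z where "x = \<Psi> \<theta> z" "z \<in> {z1<..<z2}" "\<bar>z - \<zeta> \<theta>\<bar> < \<eta>" by blast
    \<comment> \<open>The window of angles is centred at \<open>\<theta>\<close>.\<close>
    then have "x = ?f (\<theta>, z)" "(\<theta>, z) \<in> S (\<theta> - pi)" by (auto simp: S_def)
    then show "x \<in> (\<Union>\<alpha>. ?f ` S \<alpha>)" by blast
  next
    fix x assume "x \<in> (\<Union>\<alpha>. ?f ` S \<alpha>)"
    then obtain \<alpha> p where "p \<in> S \<alpha>" "x = \<Psi> (fst p) (snd p)" by (auto simp: case_prod_beta)
    then show "x \<in> {\<Psi> \<theta> z |\<theta> z. z \<in> {z1<..<z2} \<and> \<bar>z - \<zeta> \<theta>\<bar> < \<eta>}"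
      by (auto simp: S_def)
  qed
  finally show ?thesis .
qed

text \<open>The periodic solution in the strip, run through by the clock of \<open>strip_solution_clock\<close>, becomes a
closed orbit. Every point of a tube around it starts a trajectory that comes from
a solution in the strip and therefore approaches the orbit exponentially (fact \<open>tracking\<close> in the proof);
stability, attraction and, through attraction, isolation are read off from this.\<close>

theorem asymptotically_stable_limit_cycle_exists:
  "\<exists>x. asymptotically_stable_limit_cycle g x"
proof -
  obtain \<zeta> where sol: "strip_solution \<zeta>" and per: "\<And>\<theta>. \<zeta> (\<theta> + 2 * pi) = \<zeta> \<theta>"
    and mem: "\<And>\<theta>. \<zeta> \<theta> \<in> {z1<..<z2}"
    using periodic_strip_solution by blast
  have mem': "\<zeta> \<theta> \<in> {z1..z2}" for \<theta> using mem[of \<theta>] by auto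
  obtain \<tau> \<theta> where clock: "\<tau> 0 = 0" "\<And>s. (\<tau> has_real_derivative 1 / D s (retract (\<zeta> s))) (at s)"
    "\<And>s. \<theta> (\<tau> s) = s" "\<And>t. \<tau> (\<theta> t) = t"
    "\<And>t. (\<theta> has_real_derivative D (\<theta> t) (retract (\<zeta> (\<theta> t)))) (at t)"
    by (rule strip_solution_clock[OF sol, of 0]) (rule that; assumption)
  define x where "x t = \<Psi> (\<theta> t) (\<zeta> (\<theta> t))" for t
  define \<Gamma> where "\<Gamma> = range x"
  have x_\<tau>: "x (\<tau> s) = \<Psi> s (\<zeta> s)" for s by (simp add: x_def clock(3))
  have \<Psi>_in: "\<Psi> s (\<zeta> s) \<in> \<Gamma>" for s
    unfolding \<Gamma>_def x_\<tau>[symmetric] by (rule rangeI)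
  have x_sol: "ode_solution g x UNIV"
    unfolding ode_solution_def x_def using strip_solution_lifts[OF sol mem' clock(5)] by simp
  \<comment> \<open>The clock \<open>\<tau>\<close> advances by the same amount \<open>T\<close> in every turn.\<close>
  define T where "T = \<tau> (2 * pi)"
  have turn: "\<tau> (s + 2 * pi) = \<tau> s + T" for s
  proof -
    have "((\<lambda>s. \<tau> (s + 2 * pi) - \<tau> s) has_real_derivative 0) (at s)" for s
    proof -
      have "((\<lambda>s. \<tau> (s + 2 * pi)) has_real_derivative 1 / D s (retract (\<zeta> s))) (at s)"
        using clock(2)[of "s + 2 * pi"] by (simp add: DERIV_shift D_periodic per)
      from DERIV_diff[OF this clock(2)[of s]] show ?thesis by simp
    qed
    then have "\<tau> (s + 2 * pi) - \<tau> s = \<tau> (0 + 2 * pi) - \<tau> 0"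
      using DERIV_isconst_all by blast
    then show ?thesis by (simp add: T_def clock(1))
  qed
  have \<theta>_mono: "\<theta> t' \<le> \<theta> t" if "t' \<le> t" for t t'
  proof (rule DERIV_nonneg_imp_nondecreasing[OF that])
    fix u
    show "\<exists>y. (\<theta> has_real_derivative y) (at u) \<and> 0 \<le> y"
      using clock(5)[of u] D_bounds(1)[OF retract_in, of "\<theta> u" "\<zeta> (\<theta> u)"] d_pos
      by (meson less_imp_le order_trans)
  qed
  have T_pos: "T > 0"
  proof (rule ccontr)
    assume "\<not> T > 0"
    then have "\<theta> (\<tau> (2 * pi)) \<le> \<theta> (\<tau> 0)" using \<theta>_mono[of T 0] by (simp add: T_def clock(1))
    then show False using pi_gt_zero by (simp add: clock(3))
  qed
  have x_per: "x (t + T) = x t" for t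
  proof -
    have "\<theta> (t + T) = \<theta> t + 2 * pi"
      using turn[of "\<theta> t"] clock(3)[of "\<theta> t + 2 * pi"] by (simp add: clock(4))
    then show ?thesis by (simp add: x_def per \<Psi>_periodic)
  qed
  have "\<not> x constant_on UNIV"
  proof
    assume "x constant_on UNIV"
    then have "x (\<tau> 0) = x (\<tau> pi)" unfolding constant_on_def by (metis UNIV_I)
    then have "\<Psi> 0 (\<zeta> 0) = \<Psi> pi (\<zeta> pi)" by (simp only: x_\<tau>)
    then obtain n :: int where "pi = 2 * pi * n"
      using \<Psi>_inj[OF mem' mem', of 0 0 pi pi] by auto
    then have "real_of_int (2 * n) = real_of_int 1" by simp
    then have "2 * n = 1" by (simp only: of_int_eq_iff)
    then show False by presburger
  qed
  then have periodic: "nonconstant_periodic_solution g x"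
    using x_sol T_pos x_per unfolding nonconstant_periodic_solution_def by blast
  have "continuous_on UNIV x"
    using x_sol has_vector_derivative_continuous continuous_at_imp_continuous_on
    unfolding ode_solution_def by blast
  then have compact: "compact \<Gamma>"
    using compact_range_periodic[of x T] x_per T_pos by (simp add: \<Gamma>_def)
  define tube where "tube \<eta> = {\<Psi> \<theta> z |\<theta> z. z \<in> {z1<..<z2} \<and> \<bar>z - \<zeta> \<theta>\<bar> < \<eta>}" for \<eta>
  have tube_open': "open (tube \<eta>)" for \<eta>
    unfolding tube_def by (rule tube_open[OF strip_solution_cont[OF sol]])
  have \<Gamma>_tube: "\<Gamma> \<subseteq> tube \<eta>" if "\<eta> > 0" for \<eta>
  proof
    fix q assume "q \<in> \<Gamma>"
    then obtain t where "q = \<Psi> (\<theta> t) (\<zeta> (\<theta> t))" by (auto simp: \<Gamma>_def x_def)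
    moreover have "\<bar>\<zeta> (\<theta> t) - \<zeta> (\<theta> t)\<bar> < \<eta>" using that by simp
    ultimately show "q \<in> tube \<eta>" unfolding tube_def using mem by blast
  qed
  have tracking: "\<exists>y. ode_solution g y {0..} \<and> y 0 = p \<and>
      (\<forall>t\<ge>0. \<exists>q\<in>\<Gamma>. dist q (y t) \<le> L * (exp (- \<kappa> * (d * t)) * \<eta>))"
    if p: "p \<in> tube \<eta>" for p \<eta>
  proof -
    obtain s0 z0 where s0: "p = \<Psi> s0 z0" "z0 \<in> {z1..z2}" "\<bar>z0 - \<zeta> s0\<bar> < \<eta>"
      using p by (auto simp: tube_def)
    obtain \<xi> where \<xi>: "\<xi> s0 = z0" "strip_solution \<xi>"
      by (rule strip_solution_exists[of s0 z0]) (rule that; assumption)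
    obtain \<sigma> \<psi> where c: "\<sigma> s0 = 0" "\<And>s. (\<sigma> has_real_derivative 1 / D s (retract (\<xi> s))) (at s)"
      "\<And>s. \<psi> (\<sigma> s) = s" "\<And>t. \<sigma> (\<psi> t) = t"
      "\<And>t. (\<psi> has_real_derivative D (\<psi> t) (retract (\<xi> (\<psi> t)))) (at t)"
      by (rule strip_solution_clock[OF \<xi>(2), of s0]) (rule that; assumption)
    have \<psi>0: "\<psi> 0 = s0" using c(3)[of s0] unfolding c(1) .
    have \<psi>_grows: "s0 + d * t \<le> \<psi> t" if "t \<ge> 0" for t
    proof -
      have "\<psi> 0 - d * 0 \<le> \<psi> t - d * t"
      proof (rule DERIV_nonneg_imp_nondecreasing[OF that])
        fix u
        have "((\<lambda>t. \<psi> t - d * t) has_real_derivative D (\<psi> u) (retract (\<xi> (\<psi> u))) - d) (at u)"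
          by (auto intro!: derivative_eq_intros c(5))
        moreover have "0 \<le> D (\<psi> u) (retract (\<xi> (\<psi> u))) - d"
          using D_bounds(1)[OF retract_in] by simp
        ultimately show "\<exists>y. ((\<lambda>t. \<psi> t - d * t) has_real_derivative y) (at u) \<and> 0 \<le> y" by blast
      qed
      then show ?thesis by (simp add: \<psi>0)
    qed
    have \<psi>_ge: "s0 \<le> \<psi> t" if "t \<ge> 0" for t
    proof -
      have "0 \<le> d * t" using that d_pos by simp
      then show ?thesis using \<psi>_grows[OF that] by linarith
    qed
    have \<xi>_mem: "\<xi> (\<psi> t) \<in> {z1..z2}" if "t \<ge> 0" for t
      using strip_solution_stays[OF \<xi>(2), of s0 "\<psi> t"] \<xi>(1) s0(2) \<psi>_ge[OF that] by simp
    define y where "y t = \<Psi> (\<psi> t) (\<xi> (\<psi> t))" for t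
    have "(y has_vector_derivative g (y t)) (at t)" if "t \<ge> 0" for t
      unfolding y_def using strip_solution_lifts[OF \<xi>(2) \<xi>_mem[OF that] c(5)] .
    then have "ode_solution g y {0..}"
      unfolding ode_solution_def by (metis atLeast_iff has_vector_derivative_at_within)
    moreover have "y 0 = p" by (simp add: y_def \<psi>0 \<xi>(1) s0(1))
    moreover have "\<exists>q\<in>\<Gamma>. dist q (y t) \<le> L * (exp (- \<kappa> * (d * t)) * \<eta>)" if t: "t \<ge> 0" for t
    proof (rule bexI[OF _ \<Psi>_in[of "\<psi> t"]])
      have "\<bar>\<zeta> (\<psi> t) - \<xi> (\<psi> t)\<bar> \<le> exp (- \<kappa> * (\<psi> t - s0)) * \<bar>\<zeta> s0 - \<xi> s0\<bar>"
        by (rule strip_solutions_contract[OF sol \<xi>(2) mem' _ \<psi>_ge[OF t]]) (use \<xi>(1) s0(2) in simp)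
      also have "\<dots> \<le> exp (- \<kappa> * (d * t)) * \<eta>"
      proof (rule mult_mono)
        have "\<kappa> * (d * t) \<le> \<kappa> * (\<psi> t - s0)"
          using \<psi>_grows[OF t] \<kappa>_pos by (intro mult_left_mono) auto
        then show "exp (- \<kappa> * (\<psi> t - s0)) \<le> exp (- \<kappa> * (d * t))" by simp
      qed (use s0(3) \<xi>(1) in auto)
      finally have "L * \<bar>\<zeta> (\<psi> t) - \<xi> (\<psi> t)\<bar> \<le> L * (exp (- \<kappa> * (d * t)) * \<eta>)"
        by (rule mult_left_mono) (rule L_nonneg)
      then show "dist (\<Psi> (\<psi> t) (\<zeta> (\<psi> t))) (y t) \<le> L * (exp (- \<kappa> * (d * t)) * \<eta>)"
        unfolding y_def using \<Psi>_lip[OF mem' \<xi>_mem[OF t], of "\<psi> t" "\<psi> t"] by linarith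
    qed
    ultimately show ?thesis by blast
  qed
  have "attracting_set g \<Gamma>"
    unfolding attracting_set_def
  proof (intro exI[of _ "tube 1"] conjI ballI allI impI)
    show "\<exists>y. ode_solution g y {0..} \<and> y 0 = p" if "p \<in> tube 1" for p
      using tracking[OF that] by blast
    fix v assume v: "ode_solution g v {0..} \<and> v 0 \<in> tube 1"
    obtain y where y: "ode_solution g y {0..}" "y 0 = v 0"
      "\<And>t. t \<ge> 0 \<Longrightarrow> \<exists>q\<in>\<Gamma>. dist q (y t) \<le> L * (exp (- \<kappa> * (d * t)) * 1)"
      using tracking[of "v 0" 1] v by blast
    have "infdist (v t) \<Gamma> \<le> L * exp (- \<kappa> * (d * t))" if t: "t \<ge> 0" for t
    proof -
      have "v t = y t" using ode_solution_unique_forward[OF g_lip, of v y t] v y t by simp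
      then obtain q where "q \<in> \<Gamma>" "dist (v t) q \<le> L * exp (- \<kappa> * (d * t))"
        using y(3)[OF t] by (auto simp: dist_commute)
      then show ?thesis using infdist_le2 by blast
    qed
    then have "eventually (\<lambda>t. norm (infdist (v t) \<Gamma>) \<le> L * exp (- \<kappa> * (d * t))) at_top"
      by (intro eventually_mono[OF eventually_ge_at_top[of "0::real"]])
         (simp add: abs_of_nonneg infdist_nonneg)
    moreover have "((\<lambda>t. L * exp (- \<kappa> * (d * t))) \<longlongrightarrow> 0) at_top"
      using \<kappa>_pos d_pos by real_asymp
    ultimately show "((\<lambda>t. infdist (v t) \<Gamma>) \<longlongrightarrow> 0) at_top"
      by (rule Lim_null_comparison)
  qed (use tube_open' \<Gamma>_tube in auto)
  moreover have "lyapunov_stable_set g \<Gamma>"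
    unfolding lyapunov_stable_set_def
  proof (intro allI impI)
    fix V assume V: "open V \<and> \<Gamma> \<subseteq> V"
    obtain \<epsilon> where \<epsilon>: "\<epsilon> > 0" "(\<Union>q\<in>\<Gamma>. ball q \<epsilon>) \<subseteq> V"
      using compact_subset_open_imp_ball_epsilon_subset[OF compact] V by blast
    \<comment> \<open>The tube is so thin that \<open>\<Psi>\<close>, which has Lipschitz constant \<open>L\<close>, moves its points by less than \<open>\<epsilon>\<close>.\<close>
    define \<eta> where "\<eta> = \<epsilon> / (L + 1)"
    have \<eta>: "\<eta> > 0" "L * \<eta> < \<epsilon>" using \<epsilon>(1) L_nonneg by (auto simp: \<eta>_def divide_simps)
    have stay: "v t \<in> V" if T: "0 \<le> T" "ode_solution g v {0..T}" "v 0 \<in> tube \<eta>" "t \<in> {0..T}" for v T t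
    proof -
      obtain y where y: "ode_solution g y {0..}" "y 0 = v 0"
        "\<And>t. t \<ge> 0 \<Longrightarrow> \<exists>q\<in>\<Gamma>. dist q (y t) \<le> L * (exp (- \<kappa> * (d * t)) * \<eta>)"
        using tracking[OF T(3)] by blast
      have "v t = y t"
        by (rule ode_solution_unique[OF g_lip _ _ _ T(4)])
           (use T y ode_solution_subset[OF y(1), of "{0..T}"] in \<open>auto simp: ode_solution_def\<close>)
      then obtain q where q: "q \<in> \<Gamma>" "dist q (v t) \<le> L * (exp (- \<kappa> * (d * t)) * \<eta>)"
        using y(3)[of t] T(4) by auto
      have "exp (- \<kappa> * (d * t)) * \<eta> \<le> 1 * \<eta>"
        using \<kappa>_pos d_pos T(4) \<eta>(1) by (intro mult_right_mono) auto
      then have "dist q (v t) < \<epsilon>"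
        using q(2) \<eta>(2) mult_left_mono[of "exp (- \<kappa> * (d * t)) * \<eta>" \<eta> L] L_nonneg by simp
      then have "v t \<in> (\<Union>q\<in>\<Gamma>. ball q \<epsilon>)" using q(1) by auto
      then show ?thesis using \<epsilon>(2) by blast
    qed
    have "\<forall>v T. 0 \<le> T \<and> ode_solution g v {0..T} \<and> v 0 \<in> tube \<eta> \<longrightarrow> (\<forall>t\<in>{0..T}. v t \<in> V)"
      by (intro allI impI ballI, elim conjE) (rule stay)
    then show "\<exists>U. open U \<and> \<Gamma> \<subseteq> U \<and> (\<forall>v T. 0 \<le> T \<and> ode_solution g v {0..T} \<and> v 0 \<in> U \<longrightarrow>
        (\<forall>t\<in>{0..T}. v t \<in> V))"
      using tube_open'[of \<eta>] \<Gamma>_tube[OF \<eta>(1)] by (intro exI[of _ "tube \<eta>"] conjI)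
  qed
  moreover have "limit_cycle g x"
    using attracting_periodic_orbit_isolated[OF g_lip periodic] \<open>attracting_set g \<Gamma>\<close>
    by (simp add: \<Gamma>_def)
  ultimately show ?thesis
    unfolding asymptotically_stable_limit_cycle_def \<Gamma>_def by blast
qed

end


section \<open>Estimates that are uniform in a small parameter\<close>

text \<open>A family of problems is indexed by \<open>q \<in> Q\<close>, and \<open>m q\<close> measures the distance to the bifurcation. The
estimates have to hold uniformly in \<open>q\<close> once \<open>m q\<close> is small.\<close>

locale small_parameter =
  fixes Q :: "'q set" and m :: "'q \<Rightarrow> real" and z1 z2 :: real
  assumes m_pos: "q \<in> Q \<Longrightarrow> 0 < m q" and z1_pos: "0 < z1" and z12: "z1 < z2"
begin

definition small :: "('q \<Rightarrow> bool) \<Rightarrow> bool" where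
  "small P \<longleftrightarrow> (\<exists>\<mu>>0. \<forall>q\<in>Q. m q \<le> \<mu> \<longrightarrow> P q)"

lemma small_conj:
  assumes "small P" "small R" shows "small (\<lambda>q. P q \<and> R q)"
proof -
  obtain \<mu> \<nu> where "0 < \<mu>" "\<forall>q\<in>Q. m q \<le> \<mu> \<longrightarrow> P q" "0 < \<nu>" "\<forall>q\<in>Q. m q \<le> \<nu> \<longrightarrow> R q"
    using assms unfolding small_def by blast
  then show ?thesis unfolding small_def by (intro exI[of _ "min \<mu> \<nu>"]) auto
qed

lemma small_mono: "small P \<Longrightarrow> (\<And>q. q \<in> Q \<Longrightarrow> P q \<Longrightarrow> R q) \<Longrightarrow> small R"
  unfolding small_def by (elim exE conjE, rule exI, auto)

lemma small_bound: "0 < \<mu> \<Longrightarrow> small (\<lambda>q. m q \<le> \<mu>)"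
  unfolding small_def by blast

text \<open>Tame functions play the role of \<open>O(1)\<close> as \<open>m\<close> tends to zero, in the Lipschitz norm with respect to \<open>z\<close>, uniformly in the angle.
Controlling Lipschitz constants rather than derivatives makes the class closed under the
algebraic operations by elementary means, and it is just what dissipativity of the perturbed equation needs.\<close>

definition tame :: "('q \<Rightarrow> real \<Rightarrow> real \<Rightarrow> real) \<Rightarrow> bool" where
  "tame f \<longleftrightarrow> (\<exists>C>0. small (\<lambda>q. \<forall>\<theta>. \<forall>z\<in>{z1..z2}. \<bar>f q \<theta> z\<bar> \<le> C \<and>
     (\<forall>z'\<in>{z1..z2}. \<bar>f q \<theta> z - f q \<theta> z'\<bar> \<le> C * \<bar>z - z'\<bar>)))"

lemma tameI:
  assumes "small P"
    and "\<And>q \<theta> z. q \<in> Q \<Longrightarrow> P q \<Longrightarrow> z \<in> {z1..z2} \<Longrightarrow> \<bar>f q \<theta> z\<bar> \<le> B"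
    and "\<And>q \<theta> z z'. q \<in> Q \<Longrightarrow> P q \<Longrightarrow> z \<in> {z1..z2} \<Longrightarrow> z' \<in> {z1..z2} \<Longrightarrow>
      \<bar>f q \<theta> z - f q \<theta> z'\<bar> \<le> C * \<bar>z - z'\<bar>"
  shows "tame f"
  unfolding tame_def
proof (intro exI[of _ "\<bar>B\<bar> + \<bar>C\<bar> + 1"] conjI small_mono[OF assms(1)] allI ballI)
  fix q \<theta> z z' assume h: "q \<in> Q" "P q" "z \<in> {z1..z2}"
  show "\<bar>f q \<theta> z\<bar> \<le> \<bar>B\<bar> + \<bar>C\<bar> + 1"
    using assms(2)[OF h, of \<theta>] abs_ge_self[of B] abs_ge_zero[of C] by linarith
  assume z': "z' \<in> {z1..z2}"
  have "C * \<bar>z - z'\<bar> \<le> (\<bar>B\<bar> + \<bar>C\<bar> + 1) * \<bar>z - z'\<bar>" by (rule mult_right_mono) auto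
  then show "\<bar>f q \<theta> z - f q \<theta> z'\<bar> \<le> (\<bar>B\<bar> + \<bar>C\<bar> + 1) * \<bar>z - z'\<bar>"
    using assms(3)[OF h z'] by (rule order_trans[rotated])
qed auto

lemma tameE:
  assumes "tame f"
  obtains C where "C > 0" "small (\<lambda>q. \<forall>\<theta>. \<forall>z\<in>{z1..z2}. \<bar>f q \<theta> z\<bar> \<le> C \<and>
     (\<forall>z'\<in>{z1..z2}. \<bar>f q \<theta> z - f q \<theta> z'\<bar> \<le> C * \<bar>z - z'\<bar>))"
  using assms unfolding tame_def by blast

lemma tame_bounded: "(\<And>q \<theta>. q \<in> Q \<Longrightarrow> \<bar>c q \<theta>\<bar> \<le> B) \<Longrightarrow> tame (\<lambda>q \<theta> z. c q \<theta>)"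
  by (rule tameI[of "\<lambda>_. True" _ B 0]) (auto simp: small_def intro: exI[of _ "1::real"])

lemma tame_const: "tame (\<lambda>q \<theta> z. c)"
  by (rule tame_bounded[of _ "\<bar>c\<bar>"]) simp

lemma tame_id: "tame (\<lambda>q \<theta> z. z)"
  by (rule tameI[of "\<lambda>_. True" _ z2 1]) (use z1_pos in \<open>auto simp: small_def intro: exI[of _ "1::real"]\<close>)

lemma tame_sin: "tame (\<lambda>q \<theta> z. sin \<theta>)" and tame_cos: "tame (\<lambda>q \<theta> z. cos \<theta>)"
  by (rule tame_bounded[of _ 1]; simp)+

lemma tame_m: "tame (\<lambda>q \<theta> z. m q)"
  by (rule tameI[OF small_bound[of 1], of _ 1 0]) (use m_pos in \<open>auto simp: less_imp_le\<close>)

lemma tame_add: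
  assumes "tame f" "tame g" shows "tame (\<lambda>q \<theta> z. f q \<theta> z + g q \<theta> z)"
proof -
  obtain C where C: "C > 0" "small (\<lambda>q. \<forall>\<theta>. \<forall>z\<in>{z1..z2}. \<bar>f q \<theta> z\<bar> \<le> C \<and>
     (\<forall>z'\<in>{z1..z2}. \<bar>f q \<theta> z - f q \<theta> z'\<bar> \<le> C * \<bar>z - z'\<bar>))" (is "small ?P")
    using assms(1) by (rule tameE)
  obtain K where K: "K > 0" "small (\<lambda>q. \<forall>\<theta>. \<forall>z\<in>{z1..z2}. \<bar>g q \<theta> z\<bar> \<le> K \<and>
     (\<forall>z'\<in>{z1..z2}. \<bar>g q \<theta> z - g q \<theta> z'\<bar> \<le> K * \<bar>z - z'\<bar>))" (is "small ?R")
    using assms(2) by (rule tameE)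
  show ?thesis
  proof (rule tameI[OF small_conj[OF C(2) K(2)]])
    fix q \<theta> z assume h: "?P q \<and> ?R q" "z \<in> {z1..z2}"
    then have 1: "\<bar>f q \<theta> z\<bar> \<le> C" "\<bar>g q \<theta> z\<bar> \<le> K" by blast+
    then show "\<bar>f q \<theta> z + g q \<theta> z\<bar> \<le> C + K" by linarith
    fix z' assume "z' \<in> {z1..z2}"
    then have "\<bar>f q \<theta> z - f q \<theta> z'\<bar> \<le> C * \<bar>z - z'\<bar>" "\<bar>g q \<theta> z - g q \<theta> z'\<bar> \<le> K * \<bar>z - z'\<bar>"
      using h by blast+
    then show "\<bar>f q \<theta> z + g q \<theta> z - (f q \<theta> z' + g q \<theta> z')\<bar> \<le> (C + K) * \<bar>z - z'\<bar>"
      unfolding distrib_right by linarith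
  qed
qed

lemma tame_mult:
  assumes "tame f" "tame g" shows "tame (\<lambda>q \<theta> z. f q \<theta> z * g q \<theta> z)"
proof -
  obtain C where C: "C > 0" "small (\<lambda>q. \<forall>\<theta>. \<forall>z\<in>{z1..z2}. \<bar>f q \<theta> z\<bar> \<le> C \<and>
     (\<forall>z'\<in>{z1..z2}. \<bar>f q \<theta> z - f q \<theta> z'\<bar> \<le> C * \<bar>z - z'\<bar>))" (is "small ?P")
    using assms(1) by (rule tameE)
  obtain K where K: "K > 0" "small (\<lambda>q. \<forall>\<theta>. \<forall>z\<in>{z1..z2}. \<bar>g q \<theta> z\<bar> \<le> K \<and>
     (\<forall>z'\<in>{z1..z2}. \<bar>g q \<theta> z - g q \<theta> z'\<bar> \<le> K * \<bar>z - z'\<bar>))" (is "small ?R")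
    using assms(2) by (rule tameE)
  show ?thesis
  proof (rule tameI[OF small_conj[OF C(2) K(2)]])
    fix q \<theta> z assume h: "?P q \<and> ?R q" "z \<in> {z1..z2}"
    then have 1: "\<bar>f q \<theta> z\<bar> \<le> C" "\<bar>g q \<theta> z\<bar> \<le> K" by blast+
    then show "\<bar>f q \<theta> z * g q \<theta> z\<bar> \<le> C * K"
      unfolding abs_mult using C K by (intro mult_mono) auto
    fix z' assume z': "z' \<in> {z1..z2}"
    then have 2: "\<bar>f q \<theta> z - f q \<theta> z'\<bar> \<le> C * \<bar>z - z'\<bar>" "\<bar>g q \<theta> z - g q \<theta> z'\<bar> \<le> K * \<bar>z - z'\<bar>"
      "\<bar>g q \<theta> z'\<bar> \<le> K"
      using h by blast+
    have "f q \<theta> z * g q \<theta> z - f q \<theta> z' * g q \<theta> z'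
        = f q \<theta> z * (g q \<theta> z - g q \<theta> z') + (f q \<theta> z - f q \<theta> z') * g q \<theta> z'"
      by (simp add: algebra_simps)
    then have "\<bar>f q \<theta> z * g q \<theta> z - f q \<theta> z' * g q \<theta> z'\<bar>
        \<le> \<bar>f q \<theta> z\<bar> * \<bar>g q \<theta> z - g q \<theta> z'\<bar> + \<bar>f q \<theta> z - f q \<theta> z'\<bar> * \<bar>g q \<theta> z'\<bar>"
      using abs_triangle_ineq[of "f q \<theta> z * (g q \<theta> z - g q \<theta> z')" "(f q \<theta> z - f q \<theta> z') * g q \<theta> z'"]
      by (simp only: abs_mult)
    also have "\<dots> \<le> C * (K * \<bar>z - z'\<bar>) + (C * \<bar>z - z'\<bar>) * K"
      using 1 2 C K by (intro add_mono mult_mono) auto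
    finally show "\<bar>f q \<theta> z * g q \<theta> z - f q \<theta> z' * g q \<theta> z'\<bar> \<le> (2 * C * K) * \<bar>z - z'\<bar>"
      by (simp add: algebra_simps)
  qed
qed

lemma tame_minus: "tame f \<Longrightarrow> tame (\<lambda>q \<theta> z. - f q \<theta> z)"
  using tame_mult[OF tame_const[of "-1"]] by simp

lemma tame_diff: "tame f \<Longrightarrow> tame g \<Longrightarrow> tame (\<lambda>q \<theta> z. f q \<theta> z - g q \<theta> z)"
  using tame_add[OF _ tame_minus] by force

lemma tame_power: "tame f \<Longrightarrow> tame (\<lambda>q \<theta> z. f q \<theta> z ^ n)"
  by (induction n) (auto intro: tame_mult tame_const)

lemma tame_inverse:
  assumes "tame f" and d: "0 < d"
    and lower: "small (\<lambda>q. \<forall>\<theta>. \<forall>z\<in>{z1..z2}. d \<le> f q \<theta> z)" (is "small ?R")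
  shows "tame (\<lambda>q \<theta> z. 1 / f q \<theta> z)"
proof -
  obtain C where C: "C > 0" "small (\<lambda>q. \<forall>\<theta>. \<forall>z\<in>{z1..z2}. \<bar>f q \<theta> z\<bar> \<le> C \<and>
     (\<forall>z'\<in>{z1..z2}. \<bar>f q \<theta> z - f q \<theta> z'\<bar> \<le> C * \<bar>z - z'\<bar>))" (is "small ?P")
    using assms(1) by (rule tameE)
  show ?thesis
  proof (rule tameI[OF small_conj[OF C(2) lower]])
    fix q \<theta> z assume h: "?P q \<and> ?R q" "z \<in> {z1..z2}"
    then have 1: "d \<le> f q \<theta> z" by blast
    then show "\<bar>1 / f q \<theta> z\<bar> \<le> 1 / d" using d by (simp add: frac_le)
    fix z' assume z': "z' \<in> {z1..z2}"
    then have 2: "d \<le> f q \<theta> z'" "\<bar>f q \<theta> z - f q \<theta> z'\<bar> \<le> C * \<bar>z - z'\<bar>" using h by blast+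
    have "\<bar>1 / f q \<theta> z - 1 / f q \<theta> z'\<bar> = \<bar>f q \<theta> z - f q \<theta> z'\<bar> / (f q \<theta> z * f q \<theta> z')"
      using 1 2 d by (simp add: diff_frac_eq abs_divide abs_mult abs_minus_commute)
    also have "\<dots> \<le> (C * \<bar>z - z'\<bar>) / (d * d)"
      using 1 2 d C by (intro frac_le mult_mono) auto
    finally show "\<bar>1 / f q \<theta> z - 1 / f q \<theta> z'\<bar> \<le> (C / (d * d)) * \<bar>z - z'\<bar>" by simp
  qed
qed

lemma tame_divide:
  assumes "tame f" "tame g" "0 < d" "small (\<lambda>q. \<forall>\<theta>. \<forall>z\<in>{z1..z2}. d \<le> g q \<theta> z)"
  shows "tame (\<lambda>q \<theta> z. f q \<theta> z / g q \<theta> z)"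
  using tame_mult[OF assms(1) tame_inverse[OF assms(2-4)]] by simp

lemma tame_divide_id: "tame f \<Longrightarrow> tame (\<lambda>q \<theta> z. f q \<theta> z / z)"
  by (rule tame_divide[OF _ tame_id z1_pos]) (auto simp: small_def intro: exI[of _ "1::real"])

lemma small_perturbation:
  assumes "tame f" "0 < d"
  shows "small (\<lambda>q. \<forall>\<theta>. \<forall>z\<in>{z1..z2}. \<bar>m q * f q \<theta> z\<bar> \<le> d \<and>
     (\<forall>z'\<in>{z1..z2}. \<bar>m q * f q \<theta> z - m q * f q \<theta> z'\<bar> \<le> d * \<bar>z - z'\<bar>))"
proof -
  obtain C where C: "C > 0" "small (\<lambda>q. \<forall>\<theta>. \<forall>z\<in>{z1..z2}. \<bar>f q \<theta> z\<bar> \<le> C \<and>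
     (\<forall>z'\<in>{z1..z2}. \<bar>f q \<theta> z - f q \<theta> z'\<bar> \<le> C * \<bar>z - z'\<bar>))" (is "small ?P")
    using assms(1) by (rule tameE)
  have "small (\<lambda>q. ?P q \<and> m q \<le> d / C)"
    using C assms(2) by (intro small_conj small_bound) auto
  then show ?thesis
  proof (rule small_mono, intro allI ballI conjI)
    fix q \<theta> z assume q: "q \<in> Q" and h: "?P q \<and> m q \<le> d / C" and z: "z \<in> {z1..z2}"
    have m: "m q * C \<le> d" "m q > 0" using h m_pos[OF q] C by (auto simp: field_simps)
    have "m q * \<bar>f q \<theta> z\<bar> \<le> m q * C" using h z m by (intro mult_left_mono) auto
    then show "\<bar>m q * f q \<theta> z\<bar> \<le> d" using m by (simp only: abs_mult abs_of_pos)
    fix z' assume z': "z' \<in> {z1..z2}"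
    have "m q * \<bar>f q \<theta> z - f q \<theta> z'\<bar> \<le> m q * (C * \<bar>z - z'\<bar>)"
      using h z z' m by (intro mult_left_mono) auto
    also have "\<dots> \<le> d * \<bar>z - z'\<bar>"
      using mult_right_mono[OF m(1), of "\<bar>z - z'\<bar>"] by (simp add: mult.assoc)
    finally show "\<bar>m q * f q \<theta> z - m q * f q \<theta> z'\<bar> \<le> d * \<bar>z - z'\<bar>"
      using m by (simp add: abs_mult flip: right_diff_distrib)
  qed
qed

lemma small_near:
  assumes "tame f" "0 < d" "\<And>q \<theta> z. q \<in> Q \<Longrightarrow> z \<in> {z1..z2} \<Longrightarrow> 2 * d \<le> f0 q \<theta> z"
  shows "small (\<lambda>q. \<forall>\<theta>. \<forall>z\<in>{z1..z2}. d \<le> f0 q \<theta> z + m q * f q \<theta> z)"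
proof (rule small_mono[OF small_perturbation[OF assms(1,2)]], intro allI ballI)
  fix q \<theta> z assume h: "q \<in> Q" "z \<in> {z1..z2}" "\<forall>\<theta>. \<forall>z\<in>{z1..z2}. \<bar>m q * f q \<theta> z\<bar> \<le> d \<and>
     (\<forall>z'\<in>{z1..z2}. \<bar>m q * f q \<theta> z - m q * f q \<theta> z'\<bar> \<le> d * \<bar>z - z'\<bar>)"
  then have "\<bar>m q * f q \<theta> z\<bar> \<le> d" by blast
  then show "d \<le> f0 q \<theta> z + m q * f q \<theta> z" using assms(3)[OF h(1,2), of \<theta>] by linarith
qed

lemmas tame_intros = tame_add tame_mult tame_diff tame_minus tame_power tame_divide_id tame_sin
  tame_cos tame_m tame_id tame_const

end


section \<open>The supercritical Hopf normal form in averaged polar coordinates\<close>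

text \<open>The scaled system is \<open>X' = Y + m * X\<^sup>2 + m\<^sup>2 * X\<close> and
\<open>Y' = - (X + m * b * X\<^sup>2 + m\<^sup>2 * X\<^sup>3 * (h + m * X * k X))\<close>, where \<open>k\<close> collects the terms of order four and
higher. The two bounds on \<open>b\<close> place the zero \<open>sqrt (b / 2)\<close> of the averaged equation strictly
between \<open>z1\<close> and \<open>z2\<close>.\<close>

locale hopf_family = small_parameter Q m z1 z2
  for Q :: "'q set" and m :: "'q \<Rightarrow> real" and z1 z2 :: real +
  fixes b h :: "'q \<Rightarrow> real" and k :: "'q \<Rightarrow> real \<Rightarrow> real" and B :: real
  assumes b_lower: "q \<in> Q \<Longrightarrow> 4 * z1\<^sup>2 \<le> b q" and b_upper: "q \<in> Q \<Longrightarrow> b q \<le> z2\<^sup>2"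
    and h_bound: "q \<in> Q \<Longrightarrow> \<bar>h q\<bar> \<le> B"
    and k_tame: "tame f \<Longrightarrow> tame (\<lambda>q \<theta> z. k q (f q \<theta> z))"
    and k_cont: "q \<in> Q \<Longrightarrow> continuous_on UNIV (k q)"
begin

text \<open>In polar coordinates \<open>X = R * cos \<theta>\<close> and \<open>Y = - R * sin \<theta>\<close> the equations are
\<open>R' = m * R\<^sup>2 * A + m\<^sup>2 * R\<^sup>2 * E\<close> and \<open>\<theta>' = D = 1 + m * T\<close>, where \<open>T = R * P + O(m)\<close>. Hence the inverse radius
\<open>W = 1 / R\<close> satisfies \<open>dW/d\<theta> = - (m * A + m\<^sup>2 * E) / D\<close>. To first order this is \<open>- m * A\<close>, which
has mean zero and the primitive \<open>- m * A_int\<close>. To second order there appears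
\<open>m\<^sup>2 * (A * P / z - z * cos\<^sup>2 \<theta> - h * sin \<theta> * cos\<^sup>3 \<theta> / z)\<close>. The mean of \<open>cos\<^sup>2 \<theta>\<close> is \<open>1/2\<close>, the mean
of \<open>A * P - h * sin \<theta> * cos\<^sup>3 \<theta>\<close> is \<open>b / 4\<close>, and \<open>B1\<close> and \<open>- B3\<close> are primitives of the deviations
from these means. The
corrected height \<open>z\<close> is defined implicitly by \<open>W = z - m * J\<close>, which expresses the old variable
explicitly through the new one, so that no inverse function is needed. Differentiating this
relation gives \<open>dz/d\<theta> = F\<close> with \<open>F\<close> as below.\<close>

definition A where "A q \<theta> = cos \<theta> ^ 3 + b q * sin \<theta> * cos \<theta> ^ 2"
definition A_int where "A_int q \<theta> = sin \<theta> - sin \<theta> ^ 3 / 3 - b q * cos \<theta> ^ 3 / 3"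
definition P where "P q \<theta> = b q * cos \<theta> ^ 3 - cos \<theta> ^ 2 * sin \<theta>"
definition B1 :: "real \<Rightarrow> real" where "B1 \<theta> = sin \<theta> * cos \<theta> / 2"
definition B3 where "B3 q \<theta> = - h q * cos \<theta> ^ 4 / 4
    - b q * (sin \<theta> * cos \<theta> ^ 5 / 3 + sin \<theta> * cos \<theta> ^ 3 / 6 + sin \<theta> * cos \<theta> / 4)
    + (b q ^ 2 - 1) * cos \<theta> ^ 6 / 6"
definition B3' where "B3' q \<theta> = sin \<theta> * cos \<theta> ^ 3 * h q - A q \<theta> * P q \<theta> + b q / 4"

definition J where "J q \<theta> z = A_int q \<theta> + m q * (z * B1 \<theta> + B3 q \<theta> / z)"
definition W where "W q \<theta> z = z - m q * J q \<theta> z"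
definition R where "R q \<theta> z = 1 / W q \<theta> z"
definition H where "H q \<theta> z = h q + m q * (R q \<theta> z * cos \<theta> * k q (R q \<theta> z * cos \<theta>))"
definition T where "T q \<theta> z = R q \<theta> z * P q \<theta>
    + m q * (R q \<theta> z ^ 2 * cos \<theta> ^ 4 * H q \<theta> z - cos \<theta> * sin \<theta>)"
definition D where "D q \<theta> z = 1 + m q * T q \<theta> z"
definition E where "E q \<theta> z = cos \<theta> ^ 2 * W q \<theta> z + R q \<theta> z * sin \<theta> * cos \<theta> ^ 3 * H q \<theta> z"
definition drift where "drift q \<theta> z = (A q \<theta> * T q \<theta> z - E q \<theta> z) / D q \<theta> z
    + z * (cos \<theta> ^ 2 - 1/2) + B3' q \<theta> / z"
definition M where "M q \<theta> z = B1 \<theta> - B3 q \<theta> / z / z"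
definition F where "F q \<theta> z = m q ^ 2 * drift q \<theta> z / (1 - m q * (m q * M q \<theta> z))"

lemma tame_b: "tame (\<lambda>q \<theta> z. b q)"
proof (rule tame_bounded)
  fix q assume "q \<in> Q"
  then show "\<bar>b q\<bar> \<le> z2\<^sup>2"
    using b_lower[of q] b_upper[of q] zero_le_power2[of z1] by linarith
qed

lemma tame_h: "tame (\<lambda>q \<theta> z. h q)"
  by (rule tame_bounded[of _ B]) (rule h_bound)

lemma tame_A: "tame (\<lambda>q \<theta> z. A q \<theta>)"
  unfolding A_def by (intro tame_intros tame_b)

lemma tame_A_int: "tame (\<lambda>q \<theta> z. A_int q \<theta>)"
  unfolding A_int_def divide_inverse by (intro tame_intros tame_b)

lemma tame_P: "tame (\<lambda>q \<theta> z. P q \<theta>)"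
  unfolding P_def by (intro tame_intros tame_b)

lemma tame_B1: "tame (\<lambda>q \<theta> z. B1 \<theta>)"
  unfolding B1_def divide_inverse by (intro tame_intros)

lemma tame_B3: "tame (\<lambda>q \<theta> z. B3 q \<theta>)"
  unfolding B3_def divide_inverse by (intro tame_intros tame_b tame_h)

lemma tame_B3': "tame (\<lambda>q \<theta> z. B3' q \<theta>)"
  unfolding B3'_def divide_inverse by (intro tame_intros tame_b tame_h tame_A tame_P)

lemma tame_J: "tame J"
  unfolding J_def[abs_def] by (intro tame_intros tame_A_int tame_B1 tame_B3)

lemma tame_W: "tame W"
  unfolding W_def[abs_def] by (intro tame_intros tame_J)

lemma small_W: "small (\<lambda>q. \<forall>\<theta>. \<forall>z\<in>{z1..z2}. z1 / 2 \<le> W q \<theta> z)"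
  using small_near[OF tame_minus[OF tame_J], of "z1 / 2" "\<lambda>q \<theta> z. z"] z1_pos
  by (simp add: W_def)

lemma tame_R: "tame R"
  unfolding R_def[abs_def] by (rule tame_inverse[OF tame_W _ small_W]) (use z1_pos in simp)

lemma tame_k: "tame (\<lambda>q \<theta> z. k q (R q \<theta> z * cos \<theta>))"
  by (intro k_tame tame_intros tame_R)

lemma tame_H: "tame H"
  unfolding H_def[abs_def] by (intro tame_intros tame_h tame_R tame_k)

lemma tame_T: "tame T"
  unfolding T_def[abs_def] by (intro tame_intros tame_R tame_P tame_H)

lemma tame_D: "tame D"
  unfolding D_def[abs_def] by (intro tame_intros tame_T)

lemma small_D: "small (\<lambda>q. \<forall>\<theta>. \<forall>z\<in>{z1..z2}. 1 / 2 \<le> D q \<theta> z)"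
  using small_near[OF tame_T, of "1 / 2" "\<lambda>q \<theta> z. 1"] by (simp add: D_def)

lemma tame_divide_D: "tame f \<Longrightarrow> tame (\<lambda>q \<theta> z. f q \<theta> z / D q \<theta> z)"
  by (rule tame_divide[OF _ tame_D _ small_D]) auto

lemma tame_E: "tame E"
  unfolding E_def[abs_def] by (intro tame_intros tame_W tame_R tame_H)

lemma tame_drift: "tame drift"
  unfolding drift_def[abs_def] by (intro tame_intros tame_divide_D tame_A tame_T tame_E tame_B3')

lemma tame_M: "tame M"
  unfolding M_def[abs_def] by (intro tame_intros tame_B1 tame_B3)

lemma small_M: "small (\<lambda>q. \<forall>\<theta>. \<forall>z\<in>{z1..z2}. 1 / 2 \<le> 1 - m q * (m q * M q \<theta> z))"
  using small_near[OF tame_minus[OF tame_mult[OF tame_m tame_M]], of "1 / 2" "\<lambda>q \<theta> z. 1"] by simp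

lemma tame_divide_M: "tame f \<Longrightarrow> tame (\<lambda>q \<theta> z. f q \<theta> z / (1 - m q * (m q * M q \<theta> z)))"
  by (rule tame_divide[OF _ _ _ small_M]) (intro tame_intros tame_M | simp)+

lemma tame_F: "tame F"
  unfolding F_def[abs_def] by (intro tame_divide_M tame_intros tame_drift)

text \<open>The remainders are written out explicitly, because tameness can then be read off from their
syntactic form. They are found by replacing \<open>R\<close> by \<open>1 / z + m * R * J / z\<close>, then \<open>1 / D\<close> by \<open>1 - m * T / D\<close>, and
expanding \<open>H\<close>, wherever this is needed to separate the leading order.\<close>

definition drift_rest where "drift_rest q \<theta> z =
    A q \<theta> * (R q \<theta> z ^ 2 * cos \<theta> ^ 4 * H q \<theta> z - cos \<theta> * sin \<theta>)
    - T q \<theta> z * ((A q \<theta> * T q \<theta> z - E q \<theta> z) / D q \<theta> z)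
    + A q \<theta> * P q \<theta> * R q \<theta> z * J q \<theta> z / z + cos \<theta> ^ 2 * J q \<theta> z
    - sin \<theta> * cos \<theta> ^ 3 * (R q \<theta> z * cos \<theta> * k q (R q \<theta> z * cos \<theta>)) / z
    - R q \<theta> z * J q \<theta> z * sin \<theta> * cos \<theta> ^ 3 * H q \<theta> z / z"

definition F_rest where "F_rest q \<theta> z = drift_rest q \<theta> z + m q * M q \<theta> z * drift q \<theta> z / (1 - m q * (m q * M q \<theta> z))"

lemma tame_drift_rest: "tame drift_rest"
  unfolding drift_rest_def[abs_def]
  by (intro tame_intros tame_divide_D tame_A tame_P tame_R tame_J tame_T tame_E tame_H tame_k)

lemma tame_F_rest: "tame F_rest"
  unfolding F_rest_def[abs_def] by (intro tame_add tame_drift_rest tame_divide_M tame_intros tame_M tame_drift)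

text \<open>The averaged equation: all terms of order zero that oscillate with the angle cancel against
\<open>z * (cos\<^sup>2 \<theta> - 1/2) + B3' / z\<close>, for which the near-identity transformation was chosen.\<close>

lemma drift_expansion:
  assumes z: "z > 0" and W: "W q \<theta> z \<noteq> 0" and D: "D q \<theta> z \<noteq> 0"
  shows "drift q \<theta> z = - z / 2 + b q / (4 * z) + m q * drift_rest q \<theta> z"
proof -
  define a p j r w c s t e d hh where "a = A q \<theta>" "p = P q \<theta>" "j = J q \<theta> z" "r = R q \<theta> z"
    "w = W q \<theta> z" "c = cos \<theta>" "s = sin \<theta>" "t = T q \<theta> z" "e = E q \<theta> z" "d = D q \<theta> z" "hh = H q \<theta> z"
  note defs = this
  define kk where "kk = r * c * k q (r * c)"
  define u where "u = r ^ 2 * c ^ 4 * hh - c * s"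
  have r: "r = 1 / z + m q * (r * j / z)"
    using z W by (simp add: defs R_def W_def field_simps)
  have hh: "hh = h q + m q * kk" by (simp add: defs H_def kk_def)
  have w: "w = z - m q * j" by (simp add: defs W_def)
  have t: "t = r * p + m q * u" by (simp add: defs T_def u_def)
  have e: "e = c ^ 2 * w + r * s * c ^ 3 * hh" by (simp add: defs E_def)
  have d: "d = 1 + m q * t" "d \<noteq> 0" using D by (simp_all add: defs D_def)
  define G where "G = (a * t - e) / d"
  have G: "G = (a * t - e) - m q * (t * G)"
    using d(2) unfolding G_def by (simp add: divide_simps) (simp add: d(1) algebra_simps)
  define V where "V = a * u + a * p * r * j / z + c ^ 2 * j - s * c ^ 3 * kk / z - r * j * s * c ^ 3 * hh / z"
  have ate: "a * t - e = (a * p / z - c ^ 2 * z - s * c ^ 3 * h q / z) + m q * V"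
  proof -
    have 1: "a * t = a * p / z + m q * (a * u + a * p * r * j / z)"
      unfolding t by (subst r) (simp add: algebra_simps)
    have "r * s * c ^ 3 * hh = s * c ^ 3 * hh / z + m q * (r * j * s * c ^ 3 * hh / z)"
      by (subst r) (simp add: algebra_simps)
    also have "s * c ^ 3 * hh / z = s * c ^ 3 * h q / z + m q * (s * c ^ 3 * kk / z)"
      by (simp add: hh algebra_simps add_divide_distrib)
    finally show ?thesis unfolding 1 e w V_def by (simp add: algebra_simps)
  qed
  have "drift_rest q \<theta> z = V - t * G"
    unfolding drift_rest_def V_def defs[symmetric] kk_def[symmetric] u_def[symmetric] G_def by simp
  then have "m q * drift_rest q \<theta> z = m q * V - m q * (t * G)"
    by (simp add: right_diff_distrib)
  then have "G = (a * p / z - c ^ 2 * z - s * c ^ 3 * h q / z) + m q * drift_rest q \<theta> z"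
    using G unfolding ate by linarith
  then have "drift q \<theta> z = (a * p / z - c ^ 2 * z - s * c ^ 3 * h q / z) + m q * drift_rest q \<theta> z
      + z * (c ^ 2 - 1/2) + B3' q \<theta> / z"
    unfolding drift_def defs[symmetric] G_def[symmetric] by simp
  moreover have "B3' q \<theta> / z = s * c ^ 3 * h q / z - a * p / z + b q / (4 * z)"
    unfolding B3'_def defs[symmetric] by (simp add: diff_divide_distrib add_divide_distrib)
  moreover have "z * (c ^ 2 - 1/2) = c ^ 2 * z - z / 2"
    by (simp add: algebra_simps)
  ultimately show ?thesis by linarith
qed

lemma F_expansion:
  assumes z: "z > 0" and W: "W q \<theta> z \<noteq> 0" and D: "D q \<theta> z \<noteq> 0"
    and M: "1 - m q * (m q * M q \<theta> z) \<noteq> 0"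
  shows "F q \<theta> z = m q ^ 2 * (- z / 2 + b q / (4 * z) + m q * F_rest q \<theta> z)"
proof -
  let ?d = "1 - m q * (m q * M q \<theta> z)"
  have "drift q \<theta> z / ?d = drift q \<theta> z + m q * (m q * M q \<theta> z * drift q \<theta> z / ?d)"
    using M by (simp add: divide_simps) (simp add: algebra_simps)
  also have "\<dots> = - z / 2 + b q / (4 * z) + m q * F_rest q \<theta> z"
    unfolding F_rest_def using drift_expansion[OF z W D] by (simp add: algebra_simps)
  finally show ?thesis unfolding F_def by (metis times_divide_eq_right)
qed

text \<open>The properties that make \<open>q\<close> small enough for the exact equation to inherit the qualitative behaviour of the averaged one.\<close>

definition admissible :: "'q \<Rightarrow> bool" where
  "admissible q \<longleftrightarrow> (\<forall>\<theta>. \<forall>z\<in>{z1..z2}. z1 / 2 \<le> W q \<theta> z \<and> 1 / 2 \<le> D q \<theta> z \<and> 1 / 2 \<le> 1 - m q * (m q * M q \<theta> z)) \<and>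
     (\<forall>\<theta>. inj_on (W q \<theta>) {z1..z2}) \<and>
     (\<exists>L>0. \<forall>\<theta>. \<forall>z\<in>{z1..z2}. \<bar>F q \<theta> z\<bar> \<le> L \<and> \<bar>D q \<theta> z\<bar> \<le> L \<and>
        (\<forall>z'\<in>{z1..z2}. \<bar>F q \<theta> z - F q \<theta> z'\<bar> \<le> L * \<bar>z - z'\<bar> \<and> \<bar>R q \<theta> z - R q \<theta> z'\<bar> \<le> L * \<bar>z - z'\<bar>)) \<and>
     (\<forall>\<theta>. 0 < F q \<theta> z1 \<and> F q \<theta> z2 < 0) \<and>
     (\<forall>\<theta>. \<forall>z\<in>{z1..z2}. \<forall>z'\<in>{z1..z2}.
        (F q \<theta> z - F q \<theta> z') * (z - z') \<le> - (m q ^ 2 / 4) * (z - z')\<^sup>2)"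

text \<open>The averaged right-hand side \<open>\<phi> z = - z / 2 + b / (4 * z)\<close> satisfies \<open>\<phi> z1 \<ge> z1 / 2\<close> and
\<open>\<phi> z2 \<le> - z2 / 4\<close>, and decreases with slope at most \<open>- 1 / 2\<close>. An error that is bounded by \<open>z1 / 4\<close> and has
Lipschitz constant \<open>1 / 4\<close> therefore destroys neither the signs at the edges nor half of the dissipation.\<close>

lemma small_admissible: "small admissible"
proof -
  obtain CF where CF: "CF > 0" "small (\<lambda>q. \<forall>\<theta>. \<forall>z\<in>{z1..z2}. \<bar>F q \<theta> z\<bar> \<le> CF \<and>
     (\<forall>z'\<in>{z1..z2}. \<bar>F q \<theta> z - F q \<theta> z'\<bar> \<le> CF * \<bar>z - z'\<bar>))" (is "small ?F")
    using tame_F by (rule tameE)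
  obtain CD where CD: "CD > 0" "small (\<lambda>q. \<forall>\<theta>. \<forall>z\<in>{z1..z2}. \<bar>D q \<theta> z\<bar> \<le> CD \<and>
     (\<forall>z'\<in>{z1..z2}. \<bar>D q \<theta> z - D q \<theta> z'\<bar> \<le> CD * \<bar>z - z'\<bar>))" (is "small ?D")
    using tame_D by (rule tameE)
  obtain CR where CR: "CR > 0" "small (\<lambda>q. \<forall>\<theta>. \<forall>z\<in>{z1..z2}. \<bar>R q \<theta> z\<bar> \<le> CR \<and>
     (\<forall>z'\<in>{z1..z2}. \<bar>R q \<theta> z - R q \<theta> z'\<bar> \<le> CR * \<bar>z - z'\<bar>))" (is "small ?R")
    using tame_R by (rule tameE)
  \<comment> \<open>The first bound protects the signs at the edges, the second one the dissipation.\<close>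
  define \<eta> where "\<eta> = min (z1 / 4) (1 / 4)"
  have \<eta>: "\<eta> > 0" "\<eta> \<le> z1 / 4" "\<eta> \<le> 1 / 4" using z1_pos by (auto simp: \<eta>_def)
  note pert = small_conj[OF small_perturbation[OF tame_J, of "1/2"] small_perturbation[OF tame_F_rest \<eta>(1)]]
  have "small (\<lambda>q. ((?F q \<and> ?D q) \<and> ?R q) \<and>
      ((\<forall>\<theta>. \<forall>z\<in>{z1..z2}. \<bar>m q * J q \<theta> z\<bar> \<le> 1 / 2 \<and>
     (\<forall>z'\<in>{z1..z2}. \<bar>m q * J q \<theta> z - m q * J q \<theta> z'\<bar> \<le> 1 / 2 * \<bar>z - z'\<bar>)) \<and>
      (\<forall>\<theta>. \<forall>z\<in>{z1..z2}. \<bar>m q * F_rest q \<theta> z\<bar> \<le> \<eta> \<and>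
     (\<forall>z'\<in>{z1..z2}. \<bar>m q * F_rest q \<theta> z - m q * F_rest q \<theta> z'\<bar> \<le> \<eta> * \<bar>z - z'\<bar>))) \<and>
      ((\<forall>\<theta>. \<forall>z\<in>{z1..z2}. z1 / 2 \<le> W q \<theta> z) \<and> (\<forall>\<theta>. \<forall>z\<in>{z1..z2}. 1 / 2 \<le> D q \<theta> z) \<and>
       (\<forall>\<theta>. \<forall>z\<in>{z1..z2}. 1 / 2 \<le> 1 - m q * (m q * M q \<theta> z))))" (is "small ?G")
    by (rule small_conj[OF small_conj[OF small_conj[OF CF(2) CD(2)] CR(2)] small_conj[OF pert
        small_conj[OF small_W small_conj[OF small_D small_M]]]]) simp
  then show ?thesis
  proof (rule small_mono)
    fix q assume q: "q \<in> Q" and G: "?G q"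
    have mq: "m q > 0" using m_pos[OF q] .
    note GF = G[THEN conjunct1, THEN conjunct1, THEN conjunct1, rule_format]
      and GD = G[THEN conjunct1, THEN conjunct1, THEN conjunct2, rule_format]
      and GR = G[THEN conjunct1, THEN conjunct2, rule_format]
      and GJ = G[THEN conjunct2, THEN conjunct1, THEN conjunct1, rule_format]
      and GY = G[THEN conjunct2, THEN conjunct1, THEN conjunct2, rule_format]
      and GB = G[THEN conjunct2, THEN conjunct2]
    have bnds: "z1 / 2 \<le> W q \<theta> z" "1 / 2 \<le> D q \<theta> z" "1 / 2 \<le> 1 - m q * (m q * M q \<theta> z)"
      if "z \<in> {z1..z2}" for \<theta> z using GB that by blast+
    have F: "F q \<theta> z = m q ^ 2 * (- z / 2 + b q / (4 * z) + m q * F_rest q \<theta> z)"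
      if "z \<in> {z1..z2}" for \<theta> z
      by (rule F_expansion) (use bnds[OF that, of \<theta>] z1_pos that in auto)
    have J: "\<bar>m q * J q \<theta> z - m q * J q \<theta> z'\<bar> \<le> 1 / 2 * \<bar>z - z'\<bar>"
      if "z \<in> {z1..z2}" "z' \<in> {z1..z2}" for \<theta> z z'
      using GJ[OF that(1)] that(2) by blast
    have F_rest: "\<bar>m q * F_rest q \<theta> z\<bar> \<le> \<eta>" if "z \<in> {z1..z2}" for \<theta> z
      using GY[OF that] by blast
    have F_rest': "\<bar>m q * F_rest q \<theta> z - m q * F_rest q \<theta> z'\<bar> \<le> \<eta> * \<bar>z - z'\<bar>"
      if "z \<in> {z1..z2}" "z' \<in> {z1..z2}" for \<theta> z z'
      using GY[OF that(1)] that(2) by blast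
    have inj: "inj_on (W q \<theta>) {z1..z2}" for \<theta>
    proof (rule inj_onI)
      fix z z' assume z: "z \<in> {z1..z2}" "z' \<in> {z1..z2}" and eq: "W q \<theta> z = W q \<theta> z'"
      then have "z - z' = m q * J q \<theta> z - m q * J q \<theta> z'" by (simp add: W_def)
      from J[OF z, of \<theta>, folded this] show "z = z'" by (simp split: abs_split)
    qed
    have L: "\<exists>L>0. \<forall>\<theta>. \<forall>z\<in>{z1..z2}. \<bar>F q \<theta> z\<bar> \<le> L \<and> \<bar>D q \<theta> z\<bar> \<le> L \<and>
        (\<forall>z'\<in>{z1..z2}. \<bar>F q \<theta> z - F q \<theta> z'\<bar> \<le> L * \<bar>z - z'\<bar> \<and> \<bar>R q \<theta> z - R q \<theta> z'\<bar> \<le> L * \<bar>z - z'\<bar>)"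
    proof (intro exI[of _ "CF + CD + CR"] conjI allI ballI)
      fix \<theta> z assume z: "z \<in> {z1..z2}"
      have "\<bar>F q \<theta> z\<bar> \<le> CF" "\<bar>D q \<theta> z\<bar> \<le> CD" using GF[OF z] GD[OF z] by blast+
      then show "\<bar>F q \<theta> z\<bar> \<le> CF + CD + CR" "\<bar>D q \<theta> z\<bar> \<le> CF + CD + CR"
        using CF(1) CD(1) CR(1) by linarith+
      fix z' assume z': "z' \<in> {z1..z2}"
      have 1: "\<bar>F q \<theta> z - F q \<theta> z'\<bar> \<le> CF * \<bar>z - z'\<bar>" "\<bar>R q \<theta> z - R q \<theta> z'\<bar> \<le> CR * \<bar>z - z'\<bar>"
        using GF[OF z] GR[OF z] z' by blast+
      have "CF * \<bar>z - z'\<bar> \<le> (CF + CD + CR) * \<bar>z - z'\<bar>" "CR * \<bar>z - z'\<bar> \<le> (CF + CD + CR) * \<bar>z - z'\<bar>"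
        using CF(1) CD(1) CR(1) by (intro mult_right_mono; simp)+
      with 1 show "\<bar>F q \<theta> z - F q \<theta> z'\<bar> \<le> (CF + CD + CR) * \<bar>z - z'\<bar>"
        "\<bar>R q \<theta> z - R q \<theta> z'\<bar> \<le> (CF + CD + CR) * \<bar>z - z'\<bar>" by linarith+
    qed (use CF(1) CD(1) CR(1) in simp)
    have signs: "0 < F q \<theta> z1 \<and> F q \<theta> z2 < 0" for \<theta>
    proof
      have mem: "z1 \<in> {z1..z2}" "z2 \<in> {z1..z2}" using z12 by auto
      have "z1 \<le> b q / (4 * z1)"
        using b_lower[OF q] z1_pos by (simp add: field_simps power2_eq_square)
      then have "0 < - z1 / 2 + b q / (4 * z1) + m q * F_rest q \<theta> z1"
        using F_rest[OF mem(1), of \<theta>] \<eta>(2) z1_pos by linarith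
      then show "0 < F q \<theta> z1" using mq by (simp add: F[OF mem(1)])
      have "b q / (4 * z2) \<le> z2 / 4"
        using b_upper[OF q] z1_pos z12 by (simp add: field_simps power2_eq_square)
      then have "- z2 / 2 + b q / (4 * z2) + m q * F_rest q \<theta> z2 < 0"
        using F_rest[OF mem(2), of \<theta>] \<eta>(2) z1_pos z12 by linarith
      then show "F q \<theta> z2 < 0" using mq by (simp add: F[OF mem(2)] mult_pos_neg)
    qed
    have diss: "(F q \<theta> z - F q \<theta> z') * (z - z') \<le> - (m q ^ 2 / 4) * (z - z')\<^sup>2"
      if z: "z \<in> {z1..z2}" "z' \<in> {z1..z2}" for \<theta> z z'
    proof -
      have pos: "z > 0" "z' > 0" using z z1_pos by auto
      have b: "b q \<ge> 0" using b_lower[OF q] zero_le_power2[of z1] by linarith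
      have "(b q / (4 * z) - b q / (4 * z')) * (z - z') = - (b q * (z - z')\<^sup>2 / (4 * (z * z')))"
        using pos by (simp add: field_simps power2_eq_square)
      also have "\<dots> \<le> 0" using pos b by simp
      finally have 1: "(b q / (4 * z) - b q / (4 * z')) * (z - z') \<le> 0" .
      have "(m q * F_rest q \<theta> z - m q * F_rest q \<theta> z') * (z - z')
          \<le> \<bar>m q * F_rest q \<theta> z - m q * F_rest q \<theta> z'\<bar> * \<bar>z - z'\<bar>"
        by (metis abs_ge_self abs_mult)
      also have "\<dots> \<le> (1/4 * \<bar>z - z'\<bar>) * \<bar>z - z'\<bar>"
        using F_rest'[OF z, of \<theta>] mult_right_mono[OF \<eta>(3), of "\<bar>z - z'\<bar>"] by (intro mult_right_mono) auto
      also have "\<dots> = (z - z')\<^sup>2 / 4" by (simp add: power2_eq_square flip: abs_mult)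
      finally have 2: "(m q * F_rest q \<theta> z - m q * F_rest q \<theta> z') * (z - z') \<le> (z - z')\<^sup>2 / 4" .
      have "(F q \<theta> z - F q \<theta> z') * (z - z') = m q ^ 2 * (- (z - z')\<^sup>2 / 2
          + (b q / (4 * z) - b q / (4 * z')) * (z - z') + (m q * F_rest q \<theta> z - m q * F_rest q \<theta> z') * (z - z'))"
      proof -
        have "(l * (- z / 2 + \<beta> + y) - l * (- z' / 2 + \<beta>' + y')) * (z - z')
            = l * (- (z - z')\<^sup>2 / 2 + (\<beta> - \<beta>') * (z - z') + (y - y') * (z - z'))" for l \<beta> \<beta>' y y'
          by (simp add: field_simps power2_eq_square)
        then show ?thesis unfolding F[OF z(1)] F[OF z(2)] .
      qed
      also have "\<dots> \<le> m q ^ 2 * (- (z - z')\<^sup>2 / 4)"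
        using 1 2 by (intro mult_left_mono) auto
      finally show ?thesis by simp
    qed
    show "admissible q"
      unfolding admissible_def by (intro conjI allI ballI bnds inj L diss signs[THEN conjunct1] signs[THEN conjunct2])
  qed
qed

text \<open>This undoes the change of variable: along \<open>dz/d\<theta> = F\<close> the inverse radius obeys the polar form of the
system exactly, with no remainder.\<close>

lemma W_along_solution:
  assumes z: "\<zeta> \<theta> > 0" and D: "D q \<theta> (\<zeta> \<theta>) \<noteq> 0" and M: "1 - m q * (m q * M q \<theta> (\<zeta> \<theta>)) \<noteq> 0"
    and sol: "(\<zeta> has_real_derivative F q \<theta> (\<zeta> \<theta>)) (at \<theta>)"
  shows "((\<lambda>s. W q s (\<zeta> s)) has_real_derivative
    - (m q * A q \<theta> + m q ^ 2 * E q \<theta> (\<zeta> \<theta>)) / D q \<theta> (\<zeta> \<theta>)) (at \<theta>)"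
proof -
  let ?z = "\<zeta> \<theta>" and ?c = "cos \<theta>" and ?s = "sin \<theta>" and ?f = "F q \<theta> (\<zeta> \<theta>)"
  \<comment> \<open>Replacing even powers of the sine reduces trigonometric identities to polynomial ones.\<close>
  have s2: "?s ^ 2 = 1 - ?c ^ 2" by (simp add: sin_squared_eq)
  have dA: "(A_int q has_real_derivative A q \<theta>) (at \<theta>)"
  proof -
    have "(A_int q has_real_derivative ?c - ?s ^ 2 * ?c + b q * ?c ^ 2 * ?s) (at \<theta>)"
      unfolding A_int_def[abs_def] by (auto intro!: derivative_eq_intros simp: power2_eq_square)
    moreover have "?c - ?s ^ 2 * ?c + b q * ?c ^ 2 * ?s = A q \<theta>"
      unfolding A_def s2 by (simp add: algebra_simps power_numeral_reduce)
    ultimately show ?thesis by simp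
  qed
  have dB1: "(B1 has_real_derivative ?c ^ 2 - 1 / 2) (at \<theta>)"
  proof -
    have "(B1 has_real_derivative (?c ^ 2 - ?s ^ 2) / 2) (at \<theta>)"
      unfolding B1_def[abs_def] by (auto intro!: derivative_eq_intros simp: power2_eq_square)
    then show ?thesis unfolding s2 by (simp add: field_simps)
  qed
  have dB3: "(B3 q has_real_derivative B3' q \<theta>) (at \<theta>)"
  proof -
    have "(B3 q has_real_derivative h q * ?c ^ 3 * ?s
        - b q * ((?c ^ 6 - 5 * ?s ^ 2 * ?c ^ 4) / 3 + (?c ^ 4 - 3 * ?s ^ 2 * ?c ^ 2) / 6 + (?c ^ 2 - ?s ^ 2) / 4)
        - (b q ^ 2 - 1) * ?c ^ 5 * ?s) (at \<theta>)"
      unfolding B3_def[abs_def]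
      by (auto intro!: derivative_eq_intros simp: power_numeral_reduce field_simps)
    moreover have "h q * ?c ^ 3 * ?s
        - b q * ((?c ^ 6 - 5 * ?s ^ 2 * ?c ^ 4) / 3 + (?c ^ 4 - 3 * ?s ^ 2 * ?c ^ 2) / 6 + (?c ^ 2 - ?s ^ 2) / 4)
        - (b q ^ 2 - 1) * ?c ^ 5 * ?s = B3' q \<theta>"
    proof -
      \<comment> \<open>The first term has mean \<open>b / 4\<close>, the mean of \<open>cos\<^sup>6 - sin\<^sup>2 * cos\<^sup>4\<close> being \<open>5/16 - 1/16\<close>; the second one is odd.\<close>
      have AP: "A q \<theta> * P q \<theta> = b q * (?c ^ 6 - ?s ^ 2 * ?c ^ 4) + (b q ^ 2 - 1) * ?s * ?c ^ 5"
        unfolding A_def P_def by (simp add: algebra_simps power_numeral_reduce)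
      show ?thesis
        unfolding B3'_def AP s2 by (simp add: field_simps power_numeral_reduce)
    qed
    ultimately show ?thesis by simp
  qed
  have dJ: "((\<lambda>s. J q s (\<zeta> s)) has_real_derivative
      A q \<theta> + m q * (?z * (?c ^ 2 - 1/2) + B3' q \<theta> / ?z + ?f * M q \<theta> ?z)) (at \<theta>)"
    unfolding J_def M_def using z
    by (auto intro!: derivative_eq_intros dA dB1 dB3 sol simp: field_simps power2_eq_square)
  have dW: "((\<lambda>s. W q s (\<zeta> s)) has_real_derivative ?f - m q *
      (A q \<theta> + m q * (?z * (?c ^ 2 - 1/2) + B3' q \<theta> / ?z + ?f * M q \<theta> ?z))) (at \<theta>)"
    unfolding W_def by (intro DERIV_diff DERIV_cmult sol dJ)
  have f_drift: "?f * (1 - m q * (m q * M q \<theta> ?z)) = m q ^ 2 * drift q \<theta> ?z"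
    using M by (simp add: F_def)
  have "?f - m q * (A q \<theta> + m q * (?z * (?c ^ 2 - 1/2) + B3' q \<theta> / ?z + ?f * M q \<theta> ?z))
      = ?f * (1 - m q * (m q * M q \<theta> ?z)) - m q * A q \<theta> - m q ^ 2 * (?z * (?c ^ 2 - 1/2) + B3' q \<theta> / ?z)"
    by (simp add: power2_eq_square algebra_simps)
  also have "\<dots> = m q ^ 2 * ((A q \<theta> * T q \<theta> ?z - E q \<theta> ?z) / D q \<theta> ?z) - m q * A q \<theta>"
    unfolding f_drift drift_def by (simp add: distrib_left)
  also have "\<dots> = - (m q * A q \<theta> + m q ^ 2 * E q \<theta> ?z) / D q \<theta> ?z"
    using D by (simp add: divide_simps) (simp add: D_def algebra_simps power2_eq_square)
  finally show ?thesis using dW by simp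
qed

text \<open>Up to the change of time with speed \<open>D\<close>, these are the equations of the scaled system.\<close>

lemma polar_curve:
  fixes \<zeta> :: "real \<Rightarrow> real" and \<theta> :: real and q :: 'q
  defines "x \<equiv> \<lambda>s. R q s (\<zeta> s) * cos s" and "y \<equiv> \<lambda>s. - R q s (\<zeta> s) * sin s"
  assumes z: "\<zeta> \<theta> > 0" and W: "W q \<theta> (\<zeta> \<theta>) \<noteq> 0" and D: "D q \<theta> (\<zeta> \<theta>) \<noteq> 0"
    and M: "1 - m q * (m q * M q \<theta> (\<zeta> \<theta>)) \<noteq> 0"
    and sol: "(\<zeta> has_real_derivative F q \<theta> (\<zeta> \<theta>)) (at \<theta>)"
  shows "(x has_real_derivative (y \<theta> + m q * x \<theta> ^ 2 + m q ^ 2 * x \<theta>) / D q \<theta> (\<zeta> \<theta>)) (at \<theta>)"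
    and "(y has_real_derivative - (x \<theta> + m q * b q * x \<theta> ^ 2
      + m q ^ 2 * x \<theta> ^ 3 * (h q + m q * x \<theta> * k q (x \<theta>))) / D q \<theta> (\<zeta> \<theta>)) (at \<theta>)"
proof -
  define r w e d c s a hh where "r = R q \<theta> (\<zeta> \<theta>)" "w = W q \<theta> (\<zeta> \<theta>)" "e = E q \<theta> (\<zeta> \<theta>)"
    "d = D q \<theta> (\<zeta> \<theta>)" "c = cos \<theta>" "s = sin \<theta>" "a = A q \<theta>" "hh = H q \<theta> (\<zeta> \<theta>)"
  note defs = this
  have r: "r * w = 1" "r = 1 / w" using W by (simp_all add: defs R_def)
  have d0: "d \<noteq> 0" using D by (simp add: defs)
  have s2: "s ^ 2 = 1 - c ^ 2" by (simp add: defs sin_squared_eq)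
  have xy: "x \<theta> = r * c" "y \<theta> = - r * s" by (simp_all add: x_def y_def defs)
  have hh: "hh = h q + m q * (r * c * k q (r * c))" by (simp add: defs H_def)
  have e: "e = c ^ 2 * w + r * s * c ^ 3 * hh" by (simp add: defs E_def)
  have d: "d = 1 + m q * (r * (b q * c ^ 3 - c ^ 2 * s) + m q * (r ^ 2 * c ^ 4 * hh - c * s))"
    by (simp add: defs D_def T_def P_def)
  have a: "a = c ^ 3 + b q * s * c ^ 2" by (simp add: defs A_def)
  have r2e: "r ^ 2 * e = r * c ^ 2 + r ^ 3 * s * c ^ 3 * hh"
  proof -
    have "r ^ 2 * e = c ^ 2 * r * (r * w) + r ^ 3 * s * c ^ 3 * hh"
      unfolding e by (simp add: algebra_simps power_numeral_reduce)
    then show ?thesis using r(1) by simp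
  qed
  define r' where "r' = r ^ 2 * (m q * a + m q ^ 2 * e) / d"
  have dR: "((\<lambda>s. R q s (\<zeta> s)) has_real_derivative r') (at \<theta>)"
  proof -
    have "((\<lambda>s. 1 / W q s (\<zeta> s)) has_real_derivative
        - (- (m q * a + m q ^ 2 * e) / d) * r ^ 2) (at \<theta>)"
      using W_along_solution[OF z D M sol] W unfolding defs(1-4,7) R_def
      by (auto intro!: derivative_eq_intros simp: power2_eq_square)
    moreover have "- (- (m q * a + m q ^ 2 * e) / d) * r ^ 2 = r'"
      unfolding r'_def by (simp only: minus_divide_left minus_minus) simp
    ultimately show ?thesis by (simp only: R_def)
  qed
  have r'd: "r' * d = m q * r ^ 2 * a + m q ^ 2 * (r * c ^ 2 + r ^ 3 * s * c ^ 3 * hh)"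
  proof -
    have "r' * d = r ^ 2 * (m q * a + m q ^ 2 * e)" using d0 by (simp add: r'_def)
    also have "\<dots> = m q * r ^ 2 * a + m q ^ 2 * (r ^ 2 * e)" by (simp add: algebra_simps)
    finally show ?thesis unfolding r2e .
  qed
  have "(x has_real_derivative r' * c - r * s) (at \<theta>)"
    unfolding x_def by (auto intro!: derivative_eq_intros dR simp: defs)
  moreover have "(r' * c - r * s) * d = y \<theta> + m q * x \<theta> ^ 2 + m q ^ 2 * x \<theta>"
  proof -
    have "(r' * c - r * s) * d = c * (r' * d) - r * s * d" by (simp add: algebra_simps)
    also have "\<dots> = - r * s + m q * r ^ 2 * c ^ 2 * (c ^ 2 + s ^ 2) + m q ^ 2 * r * c * (c ^ 2 + s ^ 2)"
      unfolding r'd a by (subst d) (simp add: algebra_simps power_numeral_reduce)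
    finally show ?thesis unfolding xy s2 by (simp add: power_mult_distrib)
  qed
  ultimately show "(x has_real_derivative (y \<theta> + m q * x \<theta> ^ 2 + m q ^ 2 * x \<theta>) / D q \<theta> (\<zeta> \<theta>)) (at \<theta>)"
    using d0 unfolding defs(4)[symmetric] by (metis nonzero_mult_div_cancel_right)
  have "(y has_real_derivative - r' * s - r * c) (at \<theta>)"
    unfolding y_def by (auto intro!: derivative_eq_intros dR simp: defs)
  moreover have "(- r' * s - r * c) * d
      = - (x \<theta> + m q * b q * x \<theta> ^ 2 + m q ^ 2 * x \<theta> ^ 3 * (h q + m q * x \<theta> * k q (x \<theta>)))"
  proof -
    have "(- r' * s - r * c) * d = - s * (r' * d) - r * c * d" by (simp add: algebra_simps)
    also have "\<dots> = - r * c - m q * r ^ 2 * b q * c ^ 2 * (c ^ 2 + s ^ 2)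
        - m q ^ 2 * r ^ 3 * c ^ 3 * hh * (c ^ 2 + s ^ 2)"
      unfolding r'd a by (subst d) (simp add: algebra_simps power_numeral_reduce)
    also have "\<dots> = - (x \<theta> + m q * b q * x \<theta> ^ 2 + m q ^ 2 * x \<theta> ^ 3 * hh)"
      unfolding xy s2 by (simp add: power_mult_distrib)
    finally show ?thesis by (simp add: hh xy)
  qed
  ultimately show "(y has_real_derivative - (x \<theta> + m q * b q * x \<theta> ^ 2
      + m q ^ 2 * x \<theta> ^ 3 * (h q + m q * x \<theta> * k q (x \<theta>))) / D q \<theta> (\<zeta> \<theta>)) (at \<theta>)"
    using d0 unfolding defs(4)[symmetric] by (metis nonzero_mult_div_cancel_right)
qed

lemma W_cong_angle:
  assumes "sin \<theta> = sin \<theta>'" "cos \<theta> = cos \<theta>'"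
  shows "W q \<theta> z = W q \<theta>' z"
  by (simp add: assms W_def J_def A_int_def B1_def B3_def)

lemma periodic_in_angle:
  "F q (\<theta> + 2 * pi) z = F q \<theta> z" "D q (\<theta> + 2 * pi) z = D q \<theta> z" "R q (\<theta> + 2 * pi) z = R q \<theta> z"
  by (simp_all add: F_def D_def R_def drift_def M_def B1_def B3_def B3'_def E_def T_def H_def W_def J_def
      A_def A_int_def P_def)

lemma continuous_in_strip:
  assumes q: "q \<in> Q" "admissible q"
  shows "continuous_on (UNIV \<times> {z1..z2}) (\<lambda>(\<theta>, z). F q \<theta> z)"
    and "continuous_on (UNIV \<times> {z1..z2}) (\<lambda>(\<theta>, z). D q \<theta> z)"
    and "continuous_on (UNIV \<times> {z1..z2}) (\<lambda>(\<theta>, z). R q \<theta> z)"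
proof -
  let ?S = "UNIV \<times> {z1..z2} :: (real \<times> real) set"
  have ne: "snd p \<noteq> 0" "W q (fst p) (snd p) \<noteq> 0" "D q (fst p) (snd p) \<noteq> 0"
    "1 - m q * (m q * M q (fst p) (snd p)) \<noteq> 0" if "p \<in> ?S" for p
  proof -
    have "z1 / 2 \<le> W q (fst p) (snd p) \<and> 1 / 2 \<le> D q (fst p) (snd p) \<and>
      1 / 2 \<le> 1 - m q * (m q * M q (fst p) (snd p))" "z1 \<le> snd p"
      using q(2) that unfolding admissible_def by auto
    then show "snd p \<noteq> 0" "W q (fst p) (snd p) \<noteq> 0" "D q (fst p) (snd p) \<noteq> 0"
      "1 - m q * (m q * M q (fst p) (snd p)) \<noteq> 0" using z1_pos by auto
  qed
  have 1: "continuous_on ?S (\<lambda>p. A q (fst p))" "continuous_on ?S (\<lambda>p. A_int q (fst p))"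
    "continuous_on ?S (\<lambda>p. P q (fst p))" "continuous_on ?S (\<lambda>p. B1 (fst p))"
    unfolding A_def A_int_def P_def B1_def by (intro continuous_intros; simp)+
  have 2: "continuous_on ?S (\<lambda>p. B3 q (fst p))" 
    unfolding B3_def by (intro continuous_intros) auto
  have 3: "continuous_on ?S (\<lambda>p. B3' q (fst p))"
    unfolding B3'_def by (intro continuous_intros 1) auto
  have J: "continuous_on ?S (\<lambda>p. J q (fst p) (snd p))"
    unfolding J_def using ne by (intro continuous_intros 1 2) auto
  have W: "continuous_on ?S (\<lambda>p. W q (fst p) (snd p))"
    unfolding W_def by (intro continuous_intros J)
  have R: "continuous_on ?S (\<lambda>p. R q (fst p) (snd p))"
    unfolding R_def using ne by (intro continuous_intros W) auto
  have K: "continuous_on ?S (\<lambda>p. k q (R q (fst p) (snd p) * cos (fst p)))"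
    by (rule continuous_on_compose2[OF k_cont[OF q(1)]]) (intro continuous_intros R, simp)
  have H: "continuous_on ?S (\<lambda>p. H q (fst p) (snd p))"
    unfolding H_def by (intro continuous_intros R K)
  have T: "continuous_on ?S (\<lambda>p. T q (fst p) (snd p))"
    unfolding T_def by (intro continuous_intros R H 1)
  have D: "continuous_on ?S (\<lambda>p. D q (fst p) (snd p))"
    unfolding D_def by (intro continuous_intros T)
  have E: "continuous_on ?S (\<lambda>p. E q (fst p) (snd p))"
    unfolding E_def by (intro continuous_intros R W H)
  have drift: "continuous_on ?S (\<lambda>p. drift q (fst p) (snd p))"
    unfolding drift_def using ne by (intro continuous_intros 1 3 T E D) auto
  have M: "continuous_on ?S (\<lambda>p. M q (fst p) (snd p))"
    unfolding M_def using ne by (intro continuous_intros 1 2) auto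
  have "continuous_on ?S (\<lambda>p. F q (fst p) (snd p))"
    unfolding F_def using ne by (intro continuous_intros drift M) auto
  then show "continuous_on ?S (\<lambda>(\<theta>, z). F q \<theta> z)" "continuous_on ?S (\<lambda>(\<theta>, z). D q \<theta> z)"
    "continuous_on ?S (\<lambda>(\<theta>, z). R q \<theta> z)"
    using D R by (simp_all add: case_prod_beta)
qed

end


section \<open>The co-moving system near its equilibrium\<close>

text \<open>The Taylor coefficient of order \<open>j\<close> of the \<open>n\<close>-th power at \<open>x\<close>. Its exponent is truncated for \<open>n < j\<close>, where the
binomial coefficient vanishes.\<close>

definition taylor_coeff :: "nat \<Rightarrow> nat \<Rightarrow> real \<Rightarrow> real" where
  "taylor_coeff j n x = real (n choose j) * x ^ (n - j)"

text \<open>The Taylor remainder after the cubic term, divided by \<open>u\<^sup>4\<close>. The recursion avoids any division, so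
that continuity and tameness follow by induction.\<close>

primrec taylor_rest :: "nat \<Rightarrow> real \<Rightarrow> real \<Rightarrow> real" where
  "taylor_rest 0 x u = 0"
| "taylor_rest (Suc n) x u = (x + u) * taylor_rest n x u + taylor_coeff 3 n x"

lemma taylor_coeff_Suc:
  "taylor_coeff (Suc j) (Suc n) x = x * taylor_coeff (Suc j) n x + taylor_coeff j n x"
proof (cases "j < n")
  case True
  then have "n - j = Suc (n - Suc j)" by simp
  then show ?thesis by (simp add: taylor_coeff_def algebra_simps)
qed (auto simp: taylor_coeff_def binomial_eq_0)

lemma power_taylor:
  "(x + u) ^ n = x ^ n + taylor_coeff 1 n x * u + taylor_coeff 2 n x * u ^ 2
     + taylor_coeff 3 n x * u ^ 3 + taylor_rest n x u * u ^ 4"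
proof (induction n)
  case 0
  show ?case by (simp add: taylor_coeff_def binomial_eq_0)
next
  case (Suc n)
  have c: "taylor_coeff 1 (Suc n) x = x * taylor_coeff 1 n x + x ^ n"
    "taylor_coeff 2 (Suc n) x = x * taylor_coeff 2 n x + taylor_coeff 1 n x"
    "taylor_coeff 3 (Suc n) x = x * taylor_coeff 3 n x + taylor_coeff 2 n x"
    using taylor_coeff_Suc[of 0 n x] taylor_coeff_Suc[of 1 n x] taylor_coeff_Suc[of 2 n x]
    by (simp_all add: numeral_2_eq_2 numeral_3_eq_3 taylor_coeff_def)
  have "(x + u) ^ Suc n = (x + u) * (x + u) ^ n" by simp
  also have "\<dots> = (x + u) * (x ^ n + taylor_coeff 1 n x * u + taylor_coeff 2 n x * u ^ 2
     + taylor_coeff 3 n x * u ^ 3 + taylor_rest n x u * u ^ 4)" by (simp only: Suc)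
  also have "\<dots> = x ^ Suc n + taylor_coeff 1 (Suc n) x * u + taylor_coeff 2 (Suc n) x * u ^ 2
     + taylor_coeff 3 (Suc n) x * u ^ 3 + taylor_rest (Suc n) x u * u ^ 4"
    unfolding c taylor_rest.simps by (simp add: algebra_simps power_numeral_reduce)
  finally show ?case .
qed

lemma continuous_on_taylor_rest: "continuous_on S (taylor_rest n x)"
  by (induction n) (auto intro!: continuous_intros)

context small_parameter
begin

lemma tame_sum: "finite I \<Longrightarrow> (\<And>i. i \<in> I \<Longrightarrow> tame (f i)) \<Longrightarrow> tame (\<lambda>q \<theta> z. \<Sum>i\<in>I. f i q \<theta> z)"
  by (induction I rule: finite_induct) (auto intro: tame_add tame_const)

lemma tame_taylor_rest:
  assumes "tame (\<lambda>q \<theta> z. x q)" "tame f"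
  shows "tame (\<lambda>q \<theta> z. taylor_rest n (x q) (f q \<theta> z))"
  by (induction n) (auto simp: taylor_coeff_def intro!: tame_add tame_mult tame_const tame_power assms)

end

text \<open>The family is indexed by the position \<open>x\<close> of the equilibrium rather than by \<open>r = p 0 x\<close>. Here \<open>p j x\<close> is the
Taylor coefficient of order \<open>j\<close> of the sum of powers at \<open>x\<close>. The bounds \<open>z1\<close> and \<open>z2\<close> come
from the values of the coefficients at \<open>1\<close>, since these increase with \<open>x\<close>.\<close>

locale comoving_system =
  fixes N :: nat and \<epsilon> :: real
  assumes N: "N \<ge> 2" and \<epsilon>: "\<epsilon> > 0"
begin

definition p :: "nat \<Rightarrow> real \<Rightarrow> real" where
  "p j x = (\<Sum>n=1..N. taylor_coeff j n x)"

definition \<kappa> :: "real \<Rightarrow> real" where "\<kappa> x = sqrt (p 1 x * \<epsilon>)"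
definition m :: "real \<Rightarrow> real" where "m x = sqrt ((2 * x - 1) / \<kappa> x)"
definition b :: "real \<Rightarrow> real" where "b x = p 2 x * \<epsilon> / \<kappa> x"
definition h :: "real \<Rightarrow> real" where "h x = \<epsilon> * p 3 x"
definition k :: "real \<Rightarrow> real \<Rightarrow> real" where
  "k x X = \<epsilon> * \<kappa> x * (\<Sum>n=1..N. taylor_rest n x (m x * \<kappa> x * X))"
definition z1 :: real where "z1 = sqrt (\<epsilon> / sqrt (p 1 1 * \<epsilon>)) / 2"
definition z2 :: real where "z2 = z1 + sqrt (p 2 1 * \<epsilon> / sqrt \<epsilon>)"

lemma p_mono: "0 \<le> x \<Longrightarrow> x \<le> y \<Longrightarrow> p j x \<le> p j y"
  unfolding p_def taylor_coeff_def by (intro sum_mono mult_left_mono power_mono) auto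

text \<open>The summand \<open>n = j\<close> is already \<open>1\<close>. For \<open>j = 2\<close> this is the convexity that decides that the bifurcation is supercritical.\<close>

lemma p_ge_1:
  assumes "x > 0" "j \<in> {1, 2}" shows "1 \<le> p j x"
proof -
  have "taylor_coeff j j x \<le> (\<Sum>n\<in>{1..N}. taylor_coeff j n x)"
    by (rule member_le_sum) (use assms N in \<open>auto simp: taylor_coeff_def\<close>)
  then show ?thesis by (simp add: p_def taylor_coeff_def)
qed

lemma \<kappa>_pos: "x > 0 \<Longrightarrow> 0 < \<kappa> x"
  using p_ge_1[of x 1] \<epsilon> by (simp add: \<kappa>_def)

lemma \<kappa>_square: "x > 0 \<Longrightarrow> \<kappa> x ^ 2 = p 1 x * \<epsilon>"
  using p_ge_1[of x 1] \<epsilon> by (simp add: \<kappa>_def)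

lemma \<kappa>_lower: "x > 0 \<Longrightarrow> sqrt \<epsilon> \<le> \<kappa> x"
  using p_ge_1[of x 1] \<epsilon> by (simp add: \<kappa>_def)

lemma \<kappa>_upper: "x > 0 \<Longrightarrow> x \<le> 1 \<Longrightarrow> \<kappa> x \<le> sqrt (p 1 1 * \<epsilon>)"
  using p_mono[of x 1 1] \<epsilon> by (simp add: \<kappa>_def)

lemma m_square: "x > 1 / 2 \<Longrightarrow> \<kappa> x * m x ^ 2 = 2 * x - 1"
  using \<kappa>_pos[of x] by (simp add: m_def)

lemma z1_pos: "0 < z1"
  using p_ge_1[of 1 1] \<epsilon> by (simp add: z1_def)

lemma z1_z2: "z1 < z2"
  using p_ge_1[of 1 2] \<epsilon> by (simp add: z2_def)

lemma b_lower: assumes "1 / 2 < x" "x < 1" shows "4 * z1\<^sup>2 \<le> b x"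
proof -
  have p1: "1 \<le> p 1 1" and p2: "1 \<le> p 2 x" using p_ge_1 assms by simp_all
  have "4 * z1\<^sup>2 = \<epsilon> / sqrt (p 1 1 * \<epsilon>)"
    using p1 \<epsilon> by (simp add: z1_def power_divide)
  also have "\<dots> \<le> p 2 x * \<epsilon> / \<kappa> x"
    using p2 \<epsilon> \<kappa>_pos[of x] \<kappa>_upper[of x] assms by (intro frac_le) auto
  finally show ?thesis by (simp add: b_def)
qed

lemma b_upper: assumes "1 / 2 < x" "x < 1" shows "b x \<le> z2\<^sup>2"
proof -
  have p2: "1 \<le> p 2 x" "p 2 x \<le> p 2 1" using p_ge_1[of x 2] p_mono[of x 1 2] assms by simp_all
  have "b x \<le> p 2 1 * \<epsilon> / sqrt \<epsilon>"
    unfolding b_def using p2 \<epsilon> \<kappa>_lower[of x] assms by (intro frac_le mult_right_mono) auto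
  also have "\<dots> = (sqrt (p 2 1 * \<epsilon> / sqrt \<epsilon>))\<^sup>2"
    using p2 \<epsilon> by simp
  also have "\<dots> \<le> z2\<^sup>2"
    unfolding z2_def using z1_pos p2 \<epsilon> by (intro power_mono) auto
  finally show ?thesis .
qed

sublocale small_parameter "{1/2<..<1}" m z1 z2
proof
  show "0 < m q" if "q \<in> {1/2<..<1}" for q
    using that \<kappa>_pos[of q] by (simp add: m_def)
qed (fact z1_pos z1_z2)+

sublocale hopf_family "{1/2<..<1}" m z1 z2 b h k "\<epsilon> * p 3 1"
proof
  fix q :: real assume q: "q \<in> {1/2<..<1}"
  show "4 * z1\<^sup>2 \<le> b q" "b q \<le> z2\<^sup>2" using b_lower b_upper q by auto
  have "0 \<le> p 3 q" using q by (auto simp: p_def taylor_coeff_def intro!: sum_nonneg)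
  then show "\<bar>h q\<bar> \<le> \<epsilon> * p 3 1"
    using \<epsilon> p_mono[of q 1 3] q by (simp add: h_def abs_mult)
  show "continuous_on UNIV (k q)"
    unfolding k_def by (intro continuous_intros continuous_on_compose2[OF continuous_on_taylor_rest[of UNIV]]) auto
next
  fix f assume f: "tame f"
  have x: "tame (\<lambda>q \<theta> z. q)"
    by (rule tame_bounded[of _ 1]) auto
  have \<kappa>: "tame (\<lambda>q \<theta> z. \<kappa> q)"
    by (rule tame_bounded[of _ "sqrt (p 1 1 * \<epsilon>)"]) (use \<kappa>_pos \<kappa>_upper in \<open>auto simp: less_imp_le\<close>)
  show "tame (\<lambda>q \<theta> z. k q (f q \<theta> z))"
    unfolding k_def by (intro tame_mult tame_const \<kappa> tame_sum tame_taylor_rest x tame_m f) simp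
qed

text \<open>The frequency \<open>\<kappa> x / \<epsilon>\<close> of the linearized rotation and the different scales in the two directions make the linear part in the
scaled coordinates the standard rotation.\<close>

definition \<Psi> :: "real \<Rightarrow> real \<Rightarrow> real \<Rightarrow> real \<times> real" where
  "\<Psi> x \<theta> z = (x + m x * \<kappa> x * (R x \<theta> z * cos \<theta>), x * (1 - x) + m x * \<kappa> x ^ 2 * (- R x \<theta> z * sin \<theta>))"

lemma comoving_field_in_scaled_coordinates:
  assumes x: "1 / 2 < x"
  shows "comoving_field N \<epsilon> (p 0 x) (x + m x * \<kappa> x * X, x * (1 - x) + m x * \<kappa> x ^ 2 * Y)
    = (\<kappa> x / \<epsilon>) *\<^sub>R (m x * \<kappa> x * (Y + m x * X ^ 2 + m x ^ 2 * X),
        m x * \<kappa> x ^ 2 * (- (X + m x * b x * X ^ 2 + m x ^ 2 * X ^ 3 * (h x + m x * X * k x X))))"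
proof -
  define u where "u = m x * \<kappa> x * X"
  have \<kappa>0: "\<kappa> x \<noteq> 0" using \<kappa>_pos[of x] x by auto
  have \<kappa>2: "\<kappa> x ^ 2 = p 1 x * \<epsilon>" using \<kappa>_square x by simp
  have m2: "2 * x - 1 = \<kappa> x * m x ^ 2" using m_square[OF x] by simp
  have 1: "x * (1 - x) + m x * \<kappa> x ^ 2 * Y + (x + u) * (x + u - 1)
      = \<kappa> x * (m x * \<kappa> x * (Y + m x * X ^ 2 + m x ^ 2 * X))"
  proof -
    have "x * (1 - x) + m x * \<kappa> x ^ 2 * Y + (x + u) * (x + u - 1)
        = m x * \<kappa> x ^ 2 * Y + (2 * x - 1) * u + u ^ 2"
      by (simp add: algebra_simps power2_eq_square)
    also have "\<dots> = \<kappa> x * (m x * \<kappa> x * (Y + m x * X ^ 2 + m x ^ 2 * X))"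
      unfolding m2 u_def by (simp add: algebra_simps power2_eq_square)
    finally show ?thesis .
  qed
  have "(\<Sum>n=1..N. (x + u) ^ n) = p 0 x + p 1 x * u + p 2 x * u ^ 2 + p 3 x * u ^ 3
      + (\<Sum>n=1..N. taylor_rest n x u) * u ^ 4"
    unfolding power_taylor[of x u] p_def sum_distrib_right sum.distrib by (simp add: taylor_coeff_def)
  moreover have "p 1 x * u + p 2 x * u ^ 2 + p 3 x * u ^ 3 + (\<Sum>n=1..N. taylor_rest n x u) * u ^ 4
      = \<kappa> x / \<epsilon> * (m x * \<kappa> x ^ 2 * (X + m x * b x * X ^ 2 + m x ^ 2 * X ^ 3 * (h x + m x * X * k x X)))"
  proof -
    define S where "S = (\<Sum>n=1..N. taylor_rest n x u)"
    have kS: "k x X = \<epsilon> * \<kappa> x * S" by (simp add: k_def S_def u_def)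
    have p1: "p 1 x = \<kappa> x ^ 2 / \<epsilon>" using \<kappa>2 \<epsilon> by simp
    have p2: "p 2 x = b x * \<kappa> x / \<epsilon>" using \<kappa>0 \<epsilon> by (simp add: b_def)
    have p3: "p 3 x = h x / \<epsilon>" using \<epsilon> by (simp add: h_def)
    have S: "S = k x X / (\<epsilon> * \<kappa> x)" using kS \<kappa>0 \<epsilon> by simp
    show ?thesis
      unfolding S_def[symmetric] unfolding p1 p2 p3 S unfolding u_def using \<epsilon> \<kappa>0
      by (simp add: field_simps power_numeral_reduce)
  qed
  ultimately have 2: "(\<Sum>n=1..N. (x + u) ^ n) = p 0 x + \<kappa> x / \<epsilon> * (m x * \<kappa> x ^ 2 *
      (X + m x * b x * X ^ 2 + m x ^ 2 * X ^ 3 * (h x + m x * X * k x X)))"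
    by linarith
  show ?thesis
    unfolding comoving_field_def u_def[symmetric] prod.case 1 2 scaleR_Pair real_scaleR_def
    by (simp del: minus_add_distrib)
qed

lemma power_lipschitz:
  "\<exists>K\<ge>0. \<forall>x y::real. \<bar>x\<bar> \<le> r \<longrightarrow> \<bar>y\<bar> \<le> r \<longrightarrow> \<bar>x ^ n - y ^ n\<bar> \<le> K * \<bar>x - y\<bar>"
proof (induction n)
  case (Suc n)
  then obtain K where K: "K \<ge> 0" "\<And>x y::real. \<bar>x\<bar> \<le> r \<Longrightarrow> \<bar>y\<bar> \<le> r \<Longrightarrow> \<bar>x ^ n - y ^ n\<bar> \<le> K * \<bar>x - y\<bar>"
    by blast
  have "\<bar>x ^ Suc n - y ^ Suc n\<bar> \<le> (\<bar>r\<bar> * K + \<bar>r\<bar> ^ n) * \<bar>x - y\<bar>" if "\<bar>x\<bar> \<le> r" "\<bar>y\<bar> \<le> r" for x y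
  proof -
    have "x ^ Suc n - y ^ Suc n = x * (x ^ n - y ^ n) + (x - y) * y ^ n" by (simp add: algebra_simps)
    then have "\<bar>x ^ Suc n - y ^ Suc n\<bar> \<le> \<bar>x\<bar> * \<bar>x ^ n - y ^ n\<bar> + \<bar>x - y\<bar> * \<bar>y ^ n\<bar>"
      using abs_triangle_ineq[of "x * (x ^ n - y ^ n)" "(x - y) * y ^ n"] by (simp only: abs_mult)
    also have "\<dots> \<le> \<bar>r\<bar> * (K * \<bar>x - y\<bar>) + \<bar>x - y\<bar> * \<bar>r\<bar> ^ n"
      unfolding power_abs using that K by (intro add_mono mult_mono power_mono) auto
    finally show ?thesis by (simp add: algebra_simps)
  qed
  then show ?case using K(1) by (intro exI[of _ "\<bar>r\<bar> * K + \<bar>r\<bar> ^ n"]) auto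
qed (auto intro: exI[of _ 0])

lemma comoving_field_lipschitz:
  "\<exists>K. \<forall>p\<in>cball 0 r. \<forall>q\<in>cball 0 r.
     dist (comoving_field N \<epsilon> s p) (comoving_field N \<epsilon> s q) \<le> K * dist p q"
proof -
  have "\<forall>n. \<exists>K\<ge>0. \<forall>x y::real. \<bar>x\<bar> \<le> r \<longrightarrow> \<bar>y\<bar> \<le> r \<longrightarrow> \<bar>x ^ n - y ^ n\<bar> \<le> K * \<bar>x - y\<bar>"
    using power_lipschitz by blast
  then obtain K where K: "\<And>n. K n \<ge> 0"
    "\<And>n x y::real. \<bar>x\<bar> \<le> r \<Longrightarrow> \<bar>y\<bar> \<le> r \<Longrightarrow> \<bar>x ^ n - y ^ n\<bar> \<le> K n * \<bar>x - y\<bar>"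
    by metis
  define C where "C = (\<Sum>n=1..N. K n)"
  have "dist (comoving_field N \<epsilon> s (x, w)) (comoving_field N \<epsilon> s (y, v))
      \<le> ((2 + K 2) / \<epsilon> + C) * dist (x, w) (y, v)"
    if mem: "(x, w) \<in> cball 0 r" "(y, v) \<in> cball 0 r" for x w y v
  proof -
    have xy: "\<bar>x\<bar> \<le> r" "\<bar>y\<bar> \<le> r"
      using mem norm_fst_le[of x w] norm_fst_le[of y v] by (auto simp: norm_minus_commute)
    have d: "\<bar>x - y\<bar> \<le> dist (x, w) (y, v)" "\<bar>w - v\<bar> \<le> dist (x, w) (y, v)"
      using dist_fst_le[of "(x, w)" "(y, v)"] dist_snd_le[of "(x, w)" "(y, v)"] by (simp_all add: dist_real_def)
    let ?a = "(w + x * (x - 1)) / \<epsilon> - (v + y * (y - 1)) / \<epsilon>"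
    let ?b = "(\<Sum>n=1..N. y ^ n) - (\<Sum>n=1..N. x ^ n)"
    have "?a = ((w - v) + (x ^ 2 - y ^ 2) - (x - y)) / \<epsilon>"
      using \<epsilon> by (simp add: field_simps power2_eq_square)
    moreover have "\<bar>(w - v) + (x ^ 2 - y ^ 2) - (x - y)\<bar> \<le> \<bar>w - v\<bar> + K 2 * \<bar>x - y\<bar> + \<bar>x - y\<bar>"
      using K(2)[OF xy, of 2] by linarith
    moreover have "\<dots> \<le> (2 + K 2) * dist (x, w) (y, v)"
      using d mult_left_mono[OF d(1) K(1)[of 2]] by (simp add: algebra_simps)
    ultimately have 1: "\<bar>?a\<bar> \<le> (2 + K 2) / \<epsilon> * dist (x, w) (y, v)"
      using \<epsilon> by (simp add: abs_divide divide_right_mono)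
    have "\<bar>?b\<bar> = \<bar>\<Sum>n=1..N. y ^ n - x ^ n\<bar>" by (simp add: sum_subtractf)
    also have "\<dots> \<le> (\<Sum>n=1..N. K n * \<bar>y - x\<bar>)"
      by (rule order_trans[OF sum_abs sum_mono]) (rule K(2)[OF xy(2,1)])
    also have "\<dots> = C * \<bar>x - y\<bar>" by (simp add: C_def sum_distrib_right abs_minus_commute)
    also have "\<dots> \<le> C * dist (x, w) (y, v)"
      using d K(1) by (intro mult_left_mono) (auto simp: C_def sum_nonneg)
    finally have 2: "\<bar>?b\<bar> \<le> C * dist (x, w) (y, v)" .
    have "dist (comoving_field N \<epsilon> s (x, w)) (comoving_field N \<epsilon> s (y, v)) = sqrt (?a ^ 2 + ?b ^ 2)"
      by (simp add: comoving_field_def dist_Pair_Pair dist_real_def)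
    also have "\<dots> \<le> \<bar>?a\<bar> + \<bar>?b\<bar>" by (rule sqrt_sum_squares_le_sum_abs)
    finally show ?thesis using 1 2 by (simp add: distrib_right)
  qed
  then show ?thesis by (intro exI[of _ "(2 + K 2) / \<epsilon> + C"]) auto
qed

lemma cycle_at_admissible_equilibrium:
  assumes x: "x \<in> {1/2<..<1}" and admissible: "admissible x"
  shows "\<exists>\<gamma>. asymptotically_stable_limit_cycle (comoving_field N \<epsilon> (p 0 x)) \<gamma>"
proof -
  have mx: "0 < m x" using m_pos[OF x] .
  have \<kappa>x: "0 < \<kappa> x" using \<kappa>_pos x by simp
  from admissible have lower: "\<And>\<theta> z. z \<in> {z1..z2} \<Longrightarrow> z1 / 2 \<le> W x \<theta> z"
      "\<And>\<theta> z. z \<in> {z1..z2} \<Longrightarrow> 1 / 2 \<le> D x \<theta> z"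
      "\<And>\<theta> z. z \<in> {z1..z2} \<Longrightarrow> 1 / 2 \<le> 1 - m x * (m x * M x \<theta> z)"
    and inj: "\<And>\<theta>. inj_on (W x \<theta>) {z1..z2}"
    and signs: "\<And>\<theta>. 0 < F x \<theta> z1" "\<And>\<theta>. F x \<theta> z2 < 0"
    and diss: "\<And>\<theta> z z'. z \<in> {z1..z2} \<Longrightarrow> z' \<in> {z1..z2} \<Longrightarrow>
        (F x \<theta> z - F x \<theta> z') * (z - z') \<le> - (m x ^ 2 / 4) * (z - z')\<^sup>2"
    unfolding admissible_def by blast+
  from admissible obtain L where L: "0 < L" "\<And>\<theta> z. z \<in> {z1..z2} \<Longrightarrow> \<bar>F x \<theta> z\<bar> \<le> L"
      "\<And>\<theta> z. z \<in> {z1..z2} \<Longrightarrow> \<bar>D x \<theta> z\<bar> \<le> L"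
      "\<And>\<theta> z z'. z \<in> {z1..z2} \<Longrightarrow> z' \<in> {z1..z2} \<Longrightarrow> \<bar>F x \<theta> z - F x \<theta> z'\<bar> \<le> L * \<bar>z - z'\<bar>"
      "\<And>\<theta> z z'. z \<in> {z1..z2} \<Longrightarrow> z' \<in> {z1..z2} \<Longrightarrow> \<bar>R x \<theta> z - R x \<theta> z'\<bar> \<le> L * \<bar>z - z'\<bar>"
    unfolding admissible_def by blast
  define a where "a = m x * \<kappa> x + m x * \<kappa> x ^ 2"
  define L' where "L' = (1 + \<kappa> x / \<epsilon> + a) * L"
  have a: "0 < a" using mx \<kappa>x by (simp add: a_def add_pos_pos)
  have \<omega>: "0 < \<kappa> x / \<epsilon>" using \<kappa>x \<epsilon> by simp
  have L': "L \<le> L'" "\<kappa> x / \<epsilon> * L \<le> L'" "a * L \<le> L'"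
  proof -
    have "0 < \<kappa> x / \<epsilon> * L" "0 < a * L" by (rule mult_pos_pos[OF \<omega> L(1)], rule mult_pos_pos[OF a L(1)])
    moreover have "L' = L + \<kappa> x / \<epsilon> * L + a * L" by (simp only: L'_def distrib_right mult_1)
    ultimately show "L \<le> L'" "\<kappa> x / \<epsilon> * L \<le> L'" "a * L \<le> L'" using L(1) by linarith+
  qed
  have L'_mono: "c * t \<le> L' * t" if "c \<le> L'" "0 \<le> t" for c t :: real
    using that by (rule mult_right_mono)
  have Rpos: "0 < R x \<theta> z" if "z \<in> {z1..z2}" for \<theta> z
    using lower(1)[OF that, of \<theta>] z1_pos by (simp add: R_def)
  have "rotating_strip (F x) (\<lambda>\<theta> z. \<kappa> x / \<epsilon> * D x \<theta> z) (\<Psi> x) (comoving_field N \<epsilon> (p 0 x)) z1 z2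
      (m x ^ 2 / 4) L' (\<kappa> x / (2 * \<epsilon>))"
  proof
    show "continuous_on (UNIV \<times> {z1..z2}) (\<lambda>(\<theta>, z). F x \<theta> z)"
      by (rule continuous_in_strip[OF x admissible])
    show "continuous_on (UNIV \<times> {z1..z2}) (\<lambda>(\<theta>, z). \<kappa> x / \<epsilon> * D x \<theta> z)"
      using continuous_in_strip(2)[OF x admissible] unfolding case_prod_beta by (intro continuous_intros) auto
    show "continuous_on (UNIV \<times> {z1..z2}) (\<lambda>(\<theta>, z). \<Psi> x \<theta> z)"
      using continuous_in_strip(3)[OF x admissible] unfolding case_prod_beta \<Psi>_def by (intro continuous_intros) auto
    show "\<kappa> x / (2 * \<epsilon>) \<le> \<kappa> x / \<epsilon> * D x \<theta> z" "\<kappa> x / \<epsilon> * D x \<theta> z \<le> L'"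
      if "z \<in> {z1..z2}" for \<theta> z
    proof -
      show "\<kappa> x / (2 * \<epsilon>) \<le> \<kappa> x / \<epsilon> * D x \<theta> z"
        using mult_left_mono[OF lower(2)[OF that, of \<theta>], of "\<kappa> x / \<epsilon>"] \<omega> by simp
      have "D x \<theta> z \<le> L" using L(3)[OF that, of \<theta>] by linarith
      then have "\<kappa> x / \<epsilon> * D x \<theta> z \<le> \<kappa> x / \<epsilon> * L" using \<omega> by (intro mult_left_mono) auto
      then show "\<kappa> x / \<epsilon> * D x \<theta> z \<le> L'" using L'(2) by linarith
    qed
    show "dist (\<Psi> x \<theta> z) (\<Psi> x \<theta> z') \<le> L' * \<bar>z - z'\<bar>"
      if z: "z \<in> {z1..z2}" "z' \<in> {z1..z2}" for \<theta> z z'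
    proof -
      let ?d = "R x \<theta> z - R x \<theta> z'"
      have "dist (\<Psi> x \<theta> z) (\<Psi> x \<theta> z')
          = sqrt ((m x * \<kappa> x * (?d * cos \<theta>))\<^sup>2 + (m x * \<kappa> x ^ 2 * (?d * sin \<theta>))\<^sup>2)"
        unfolding \<Psi>_def dist_Pair_Pair dist_real_def power2_abs
        by (rule arg_cong[of _ _ sqrt]) (simp add: power2_eq_square algebra_simps)
      also have "\<dots> \<le> \<bar>m x * \<kappa> x * (?d * cos \<theta>)\<bar> + \<bar>m x * \<kappa> x ^ 2 * (?d * sin \<theta>)\<bar>"
        by (rule sqrt_sum_squares_le_sum_abs)
      also have "\<dots> = m x * \<kappa> x * (\<bar>?d\<bar> * \<bar>cos \<theta>\<bar>) + m x * \<kappa> x ^ 2 * (\<bar>?d\<bar> * \<bar>sin \<theta>\<bar>)"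
        using mx \<kappa>x by (simp add: abs_mult)
      also have "\<dots> \<le> m x * \<kappa> x * (\<bar>?d\<bar> * 1) + m x * \<kappa> x ^ 2 * (\<bar>?d\<bar> * 1)"
        using mx \<kappa>x by (intro add_mono mult_left_mono) auto
      also have "\<dots> = a * \<bar>?d\<bar>" by (simp add: a_def algebra_simps)
      also have "\<dots> \<le> a * (L * \<bar>z - z'\<bar>)" using L(5)[OF z] a by (intro mult_left_mono) auto
      also have "\<dots> \<le> L' * \<bar>z - z'\<bar>" using L'_mono[OF L'(3)] by (simp add: mult.assoc)
      finally show ?thesis .
    qed
    show "z = z' \<and> (\<exists>n::int. \<theta>' = \<theta> + 2 * pi * real_of_int n)"
      if z: "z \<in> {z1..z2}" "z' \<in> {z1..z2}" and eq: "\<Psi> x \<theta> z = \<Psi> x \<theta>' z'" for \<theta> \<theta>' z z'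
    proof -
      let ?r = "R x \<theta> z" and ?r' = "R x \<theta>' z'"
      have pos: "0 < ?r" "0 < ?r'" using Rpos z by blast+
      have cs: "?r * cos \<theta> = ?r' * cos \<theta>'" "?r * sin \<theta> = ?r' * sin \<theta>'"
        using eq mx \<kappa>x by (auto simp: \<Psi>_def)
      have "?r\<^sup>2 * (cos \<theta> ^ 2 + sin \<theta> ^ 2) = ?r'\<^sup>2 * (cos \<theta>' ^ 2 + sin \<theta>' ^ 2)"
        using cs by (simp only: distrib_left power_mult_distrib[symmetric])
      then have r: "?r = ?r'" using pos by (simp add: power2_eq_imp_eq)
      then have sc: "sin \<theta> = sin \<theta>'" "cos \<theta> = cos \<theta>'" using cs pos by auto
      then obtain n :: int where "\<theta>' = \<theta> + 2 * pi * n" using sin_cos_eq_iff[of \<theta>' \<theta>] by auto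
      moreover have "W x \<theta> z = W x \<theta> z'"
        using r W_cong_angle[OF sc, of x z'] by (simp add: R_def)
      then have "z = z'" using inj_onD[OF inj _ z] by blast
      ultimately show ?thesis by blast
    qed
    show "((\<lambda>s. \<Psi> x s (\<zeta> s)) has_vector_derivative
        (1 / (\<kappa> x / \<epsilon> * D x \<theta> (\<zeta> \<theta>))) *\<^sub>R comoving_field N \<epsilon> (p 0 x) (\<Psi> x \<theta> (\<zeta> \<theta>))) (at \<theta>)"
      if mem: "\<zeta> \<theta> \<in> {z1..z2}" and sol: "(\<zeta> has_real_derivative F x \<theta> (\<zeta> \<theta>)) (at \<theta>)" for \<zeta> \<theta>
    proof -
      define X where "X s = R x s (\<zeta> s) * cos s" for s
      define Y where "Y s = - R x s (\<zeta> s) * sin s" for s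
      let ?D = "D x \<theta> (\<zeta> \<theta>)"
      have ne: "\<zeta> \<theta> > 0" "W x \<theta> (\<zeta> \<theta>) \<noteq> 0" "?D \<noteq> 0" "1 - m x * (m x * M x \<theta> (\<zeta> \<theta>)) \<noteq> 0"
        using lower[OF mem, of \<theta>] mem z1_pos by auto
      define f1 where "f1 = Y \<theta> + m x * X \<theta> ^ 2 + m x ^ 2 * X \<theta>"
      define f2 where "f2 = - (X \<theta> + m x * b x * X \<theta> ^ 2
          + m x ^ 2 * X \<theta> ^ 3 * (h x + m x * X \<theta> * k x (X \<theta>)))"
      have dX: "(X has_real_derivative f1 / ?D) (at \<theta>)" and dY: "(Y has_real_derivative f2 / ?D) (at \<theta>)"
        using polar_curve[where \<zeta> = \<zeta> and \<theta> = \<theta> and q = x, OF ne sol]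
        unfolding X_def[abs_def] Y_def[abs_def] f1_def f2_def by simp_all
      have curve: "\<Psi> x s (\<zeta> s) = (x + m x * \<kappa> x * X s, x * (1 - x) + m x * \<kappa> x ^ 2 * Y s)" for s
        by (simp add: \<Psi>_def X_def Y_def)
      have "((\<lambda>s. x + m x * \<kappa> x * X s) has_vector_derivative m x * \<kappa> x * (f1 / ?D)) (at \<theta>)"
        "((\<lambda>s. x * (1 - x) + m x * \<kappa> x ^ 2 * Y s) has_vector_derivative m x * \<kappa> x ^ 2 * (f2 / ?D)) (at \<theta>)"
        unfolding has_real_derivative_iff_has_vector_derivative[symmetric]
        by (auto intro!: derivative_eq_intros dX dY)
      then have "((\<lambda>s. \<Psi> x s (\<zeta> s)) has_vector_derivative
          (m x * \<kappa> x * (f1 / ?D), m x * \<kappa> x ^ 2 * (f2 / ?D))) (at \<theta>)"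
        unfolding curve by (rule has_vector_derivative_Pair)
      moreover have "(1 / (\<kappa> x / \<epsilon> * ?D)) *\<^sub>R comoving_field N \<epsilon> (p 0 x) (\<Psi> x \<theta> (\<zeta> \<theta>))
          = (m x * \<kappa> x * (f1 / ?D), m x * \<kappa> x ^ 2 * (f2 / ?D))"
      proof -
        have "comoving_field N \<epsilon> (p 0 x) (\<Psi> x \<theta> (\<zeta> \<theta>))
            = (\<kappa> x / \<epsilon>) *\<^sub>R (m x * \<kappa> x * f1, m x * \<kappa> x ^ 2 * f2)"
          unfolding curve f1_def f2_def by (rule comoving_field_in_scaled_coordinates) (use x in simp)
        then show ?thesis using ne(3) \<kappa>x \<epsilon> by simp
      qed
      ultimately show ?thesis by simp
    qed
    show "\<exists>K. \<forall>p'\<in>cball 0 r. \<forall>q\<in>cball 0 r. dist (comoving_field N \<epsilon> (p 0 x) p') (comoving_field N \<epsilon> (p 0 x) q)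
        \<le> K * dist p' q" for r
      by (rule comoving_field_lipschitz)
    show "\<bar>F x \<theta> z - F x \<theta> z'\<bar> \<le> L' * \<bar>z - z'\<bar>" if "z \<in> {z1..z2}" "z' \<in> {z1..z2}" for \<theta> z z'
      using L(4)[OF that, of \<theta>] L'_mono[OF L'(1), of "\<bar>z - z'\<bar>"] by simp
    show "\<bar>F x \<theta> z\<bar> \<le> L'" if "z \<in> {z1..z2}" for \<theta> z
      using L(2)[OF that, of \<theta>] L'(1) by linarith
  qed (use mx \<kappa>x \<epsilon> L(1) L'(1) z1_z2 signs diss in \<open>auto simp: periodic_in_angle \<Psi>_def\<close>)
  then show ?thesis by (rule rotating_strip.asymptotically_stable_limit_cycle_exists)
qed

text \<open>For equilibria close to \<open>1/2\<close> the parameter \<open>m\<close> is small, and by the intermediate value theorem these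
equilibria account for all \<open>r\<close> slightly above \<open>p 0 (1/2)\<close>.\<close>

lemma cycle_past_threshold:
  "\<exists>\<delta>>0. \<forall>r\<in>{p 0 (1/2)<..<p 0 (1/2) + \<delta>}. \<exists>\<gamma>. asymptotically_stable_limit_cycle (comoving_field N \<epsilon> r) \<gamma>"
proof -
  obtain \<mu> where \<mu>: "\<mu> > 0" "\<And>x. x \<in> {1/2<..<1} \<Longrightarrow> m x \<le> \<mu> \<Longrightarrow> admissible x"
    using small_admissible unfolding small_def by blast
  \<comment> \<open>Since \<open>\<kappa> x \<ge> sqrt \<epsilon>\<close>, this choice gives \<open>m x\<^sup>2 \<le> (2 * y - 1) / sqrt \<epsilon> \<le> \<mu>\<^sup>2\<close> for \<open>x \<le> y\<close>.\<close>
  define y where "y = min (3 / 4) (1 / 2 + \<mu>\<^sup>2 * sqrt \<epsilon> / 2)"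
  have y: "1 / 2 < y" "y < 1" "2 * y - 1 \<le> \<mu>\<^sup>2 * sqrt \<epsilon>"
  proof -
    have "0 < \<mu>\<^sup>2 * sqrt \<epsilon>" using \<mu>(1) \<epsilon> by simp
    then show "1 / 2 < y" "y < 1" by (simp_all add: y_def)
    have "y \<le> 1 / 2 + \<mu>\<^sup>2 * sqrt \<epsilon> / 2" unfolding y_def by (rule min.cobounded2)
    then show "2 * y - 1 \<le> \<mu>\<^sup>2 * sqrt \<epsilon>" by linarith
  qed
  have admissible: "admissible x" if x: "1 / 2 < x" "x \<le> y" for x
  proof (rule \<mu>(2))
    have "(2 * x - 1) / \<kappa> x \<le> (2 * y - 1) / sqrt \<epsilon>"
      using x \<kappa>_lower[of x] \<epsilon> by (intro frac_le) auto
    also have "\<dots> \<le> \<mu>\<^sup>2" using y(3) \<epsilon> by (simp add: divide_le_eq)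
    finally show "m x \<le> \<mu>" unfolding m_def using \<mu>(1) by (intro real_le_lsqrt) auto
  qed (use x y in auto)
  have cont: "continuous_on {1/2..y} (p 0)"
    unfolding p_def taylor_coeff_def by (intro continuous_intros)
  have "p 0 (1/2) < p 0 y"
    unfolding p_def taylor_coeff_def using N y(1)
    by (intro sum_strict_mono) (auto intro!: power_strict_mono)
  moreover have "\<exists>\<gamma>. asymptotically_stable_limit_cycle (comoving_field N \<epsilon> r) \<gamma>"
    if r: "p 0 (1/2) < r" "r < p 0 y" for r
  proof -
    obtain x where x: "1 / 2 \<le> x" "x \<le> y" "p 0 x = r"
      using IVT'[of "p 0" "1/2" r y] r cont y(1) by auto
    then have "x \<noteq> 1 / 2" using r(1) by blast
    then have "1 / 2 < x" "x < 1" using x y(2) by linarith+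
    then show ?thesis using cycle_at_admissible_equilibrium[of x] admissible[of x] x(2,3) by simp
  qed
  ultimately show ?thesis by (intro exI[of _ "p 0 y - p 0 (1/2)"]) auto
qed

end


section \<open>From the co-moving to the fast/slow system\<close>

lemma fast_slow_solution_of_comoving:
  assumes "ode_solution (comoving_field N \<epsilon> r) (\<lambda>t. (x t, w t)) S"
  shows "ode_solution (fast_slow_field N \<epsilon> r) (\<lambda>t. (x t, w t - r * t, r * t)) S"
  unfolding ode_solution_def
proof
  fix t assume "t \<in> S"
  then have der: "((\<lambda>t. (x t, w t)) has_vector_derivative comoving_field N \<epsilon> r (x t, w t)) (at t within S)"
    using assms by (simp add: ode_solution_def)
  have "(x has_vector_derivative (w t + x t * (x t - 1)) / \<epsilon>) (at t within S)"
    "(w has_vector_derivative - (\<Sum>n=1..N. x t ^ n) + r) (at t within S)"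
    using bounded_linear.has_vector_derivative[OF bounded_linear_fst der]
      bounded_linear.has_vector_derivative[OF bounded_linear_snd der]
    by (simp_all add: comoving_field_def)
  then have "((\<lambda>t. (x t, w t - r * t, r * t)) has_vector_derivative
      ((w t + x t * (x t - 1)) / \<epsilon>, - (\<Sum>n=1..N. x t ^ n) + r - r, r)) (at t within S)"
    by (auto intro!: has_vector_derivative_Pair derivative_eq_intros)
  then show "((\<lambda>t. (x t, w t - r * t, r * t)) has_vector_derivative
      fast_slow_field N \<epsilon> r (x t, w t - r * t, r * t)) (at t within S)"
    by (simp add: fast_slow_field_def)
qed

lemma comoving_solution_of_fast_slow:
  assumes sol: "ode_solution (fast_slow_field N \<epsilon> r) (\<lambda>t. (x t, y t, l t)) S"
    and l: "\<And>t. t \<in> S \<Longrightarrow> l t = r * t"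
  shows "ode_solution (comoving_field N \<epsilon> r) (\<lambda>t. (x t, y t + r * t)) S"
  unfolding ode_solution_def
proof
  fix t assume t: "t \<in> S"
  then have der: "((\<lambda>t. (x t, y t, l t)) has_vector_derivative fast_slow_field N \<epsilon> r (x t, y t, l t)) (at t within S)"
    using sol by (simp add: ode_solution_def)
  note der' = bounded_linear.has_vector_derivative[OF bounded_linear_snd der]
  have "(x has_vector_derivative (y t + r * t + x t * (x t - 1)) / \<epsilon>) (at t within S)"
    "(y has_vector_derivative - (\<Sum>n=1..N. x t ^ n)) (at t within S)"
    using bounded_linear.has_vector_derivative[OF bounded_linear_fst der]
      bounded_linear.has_vector_derivative[OF bounded_linear_fst der'] l[OF t]
    by (simp_all add: fast_slow_field_def)
  then have "((\<lambda>t. (x t, y t + r * t)) has_vector_derivative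
      ((y t + r * t + x t * (x t - 1)) / \<epsilon>, - (\<Sum>n=1..N. x t ^ n) + r)) (at t within S)"
    by (auto intro!: has_vector_derivative_Pair derivative_eq_intros)
  then show "((\<lambda>t. (x t, y t + r * t)) has_vector_derivative
      comoving_field N \<epsilon> r (x t, y t + r * t)) (at t within S)"
    by (simp add: comoving_field_def)
qed

text \<open>Since \<open>\<lambda> = r * t\<close> along the solutions considered, the co-moving variable is \<open>w = x2 + r * t\<close>. The
neighbourhood of attraction of the limit cycle of the co-moving system serves as \<open>U\<close>.\<close>

theorem corollary2:
  fixes N :: nat and \<epsilon> r\<^sub>c :: real
  assumes "N \<ge> 5" and "odd N" and "\<epsilon> > 0"
    and "r\<^sub>c = (\<Sum>n=1..N. (1/2) ^ n)"
  shows "\<exists>\<delta>>0. \<forall>r\<in>{r\<^sub>c<..<r\<^sub>c + \<delta>}. \<exists>x1s ws :: real \<Rightarrow> real.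
      asymptotically_stable_limit_cycle (comoving_field N \<epsilon> r) (\<lambda>t. (x1s t, ws t)) \<and>
      ode_solution (fast_slow_field N \<epsilon> r) (\<lambda>t. (x1s t, ws t - r * t, r * t)) UNIV \<and>
      (\<exists>U. open U \<and> range (\<lambda>t. (x1s t, ws t)) \<subseteq> U \<and>
         (\<forall>(p, q)\<in>U. \<exists>x1 x2. x1 0 = p \<and> x2 0 = q \<and>
            ode_solution (fast_slow_field N \<epsilon> r) (\<lambda>t. (x1 t, x2 t, r * t)) {0..}) \<and>
         (\<forall>x1 x2 l. ode_solution (fast_slow_field N \<epsilon> r) (\<lambda>t. (x1 t, x2 t, l t)) {0..} \<and>
            (\<forall>t\<ge>0. l t = r * t) \<and> (x1 0, x2 0) \<in> U \<longrightarrow>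
            ((\<lambda>t. infdist (x1 t, x2 t + r * t) (range (\<lambda>t. (x1s t, ws t)))) \<longlongrightarrow> 0) at_top))"
proof -
  interpret comoving_system N \<epsilon> by standard (use assms in auto)
  have rc: "r\<^sub>c = p 0 (1/2)" using assms(4) by (simp add: p_def taylor_coeff_def)
  obtain \<delta> where \<delta>: "\<delta> > 0" and
    cycle: "\<And>r. r \<in> {r\<^sub>c<..<r\<^sub>c + \<delta>} \<Longrightarrow> \<exists>\<gamma>. asymptotically_stable_limit_cycle (comoving_field N \<epsilon> r) \<gamma>"
    using cycle_past_threshold unfolding rc by blast
  show ?thesis
  proof (intro exI[of _ \<delta>] conjI ballI \<delta>)
    fix r assume "r \<in> {r\<^sub>c<..<r\<^sub>c + \<delta>}"
    then obtain \<gamma> where \<gamma>: "asymptotically_stable_limit_cycle (comoving_field N \<epsilon> r) \<gamma>"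
      using cycle by blast
    define x1s where "x1s t = fst (\<gamma> t)" for t
    define ws where "ws t = snd (\<gamma> t)" for t
    have \<gamma>_eq: "(\<lambda>t. (x1s t, ws t)) = \<gamma>" by (simp add: x1s_def ws_def)
    have sol: "ode_solution (comoving_field N \<epsilon> r) (\<lambda>t. (x1s t, ws t)) UNIV"
      using \<gamma> unfolding \<gamma>_eq asymptotically_stable_limit_cycle_def limit_cycle_def
        nonconstant_periodic_solution_def by blast
    obtain U where U: "open U" "range \<gamma> \<subseteq> U"
      and exist: "\<And>p. p \<in> U \<Longrightarrow> \<exists>y. ode_solution (comoving_field N \<epsilon> r) y {0..} \<and> y 0 = p"
      and conv: "\<And>y. ode_solution (comoving_field N \<epsilon> r) y {0..} \<Longrightarrow> y 0 \<in> U \<Longrightarrow>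
        ((\<lambda>t. infdist (y t) (range \<gamma>)) \<longlongrightarrow> 0) at_top"
      using \<gamma> unfolding asymptotically_stable_limit_cycle_def attracting_set_def by blast
    have exist': "\<exists>x1 x2. x1 0 = p' \<and> x2 0 = q' \<and>
        ode_solution (fast_slow_field N \<epsilon> r) (\<lambda>t. (x1 t, x2 t, r * t)) {0..}" if pq: "(p', q') \<in> U" for p' q'
    proof -
      obtain y where y: "ode_solution (comoving_field N \<epsilon> r) y {0..}" "y 0 = (p', q')"
        using exist[OF pq] by blast
      have "ode_solution (comoving_field N \<epsilon> r) (\<lambda>t. (fst (y t), snd (y t))) {0..}"
        using y(1) by simp
      from fast_slow_solution_of_comoving[OF this] show ?thesis
        using y(2) by (intro exI[of _ "\<lambda>t. fst (y t)"] exI[of _ "\<lambda>t. snd (y t) - r * t"]) simp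
    qed
    have conv': "((\<lambda>t. infdist (x1 t, x2 t + r * t) (range \<gamma>)) \<longlongrightarrow> 0) at_top"
      if "ode_solution (fast_slow_field N \<epsilon> r) (\<lambda>t. (x1 t, x2 t, l t)) {0..}"
        "\<forall>t\<ge>0. l t = r * t" "(x1 0, x2 0) \<in> U" for x1 x2 l
      using conv[OF comoving_solution_of_fast_slow[OF that(1)]] that(2,3) by simp
    show "\<exists>x1s ws :: real \<Rightarrow> real.
      asymptotically_stable_limit_cycle (comoving_field N \<epsilon> r) (\<lambda>t. (x1s t, ws t)) \<and>
      ode_solution (fast_slow_field N \<epsilon> r) (\<lambda>t. (x1s t, ws t - r * t, r * t)) UNIV \<and>
      (\<exists>U. open U \<and> range (\<lambda>t. (x1s t, ws t)) \<subseteq> U \<and>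
         (\<forall>(p, q)\<in>U. \<exists>x1 x2. x1 0 = p \<and> x2 0 = q \<and>
            ode_solution (fast_slow_field N \<epsilon> r) (\<lambda>t. (x1 t, x2 t, r * t)) {0..}) \<and>
         (\<forall>x1 x2 l. ode_solution (fast_slow_field N \<epsilon> r) (\<lambda>t. (x1 t, x2 t, l t)) {0..} \<and>
            (\<forall>t\<ge>0. l t = r * t) \<and> (x1 0, x2 0) \<in> U \<longrightarrow>
            ((\<lambda>t. infdist (x1 t, x2 t + r * t) (range (\<lambda>t. (x1s t, ws t)))) \<longlongrightarrow> 0) at_top))"
    proof (rule exI[of _ x1s], rule exI[of _ ws], unfold \<gamma>_eq, intro conjI exI[of _ U])
      show "\<forall>(p, q)\<in>U. \<exists>x1 x2. x1 0 = p \<and> x2 0 = q \<and>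
          ode_solution (fast_slow_field N \<epsilon> r) (\<lambda>t. (x1 t, x2 t, r * t)) {0..}"
        using exist' by auto
    qed (use \<gamma> U conv' fast_slow_solution_of_comoving[OF sol] in blast)+
  qed
qed

end
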